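(* There is an absolute constant $C>0$ such that for every (sufficiently large) prime $p$ and all functions $f_1,f_2:\mathbb{F}_p\to\mathbb{C}$, $$\|T(f_1,f_2)\|_2\le C\,p^{-3/16}\,\|f_1\|_2\,\|f_2\|_2 .$$
   Context: Let $p$ be an odd prime and $\mathbb{F}_p$ the field with $p$ elements. For $x\in\mathbb{F}_p$ write $e_p(x)=e^{-2\pi i x/p}$ (well defined on $\mathbb{F}_p$). For $f:\mathbb{F}_p\to\mathbb{C}$, $\|f\|_2=\big(\sum_{x\in\mathbb{F}_p}|f(x)|^2\big)^{1/2}$. Define the kernel $K(a,b)=\frac1p\sum_{y\in\mathbb{F}_p}e_p(ay^2+by)$ for $a,b\in\mathbb{F}_p$, and the bilinear operator $$T(f_1,f_2)(s)=\sum_{n\in\mathbb{F}_p,\ n\neq s} f_1(s-n)\,f_2(n)\,K(s-n,n),\qquad s\in\mathbb{F}_p.$$ *)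

theory Defs
  imports Complex_Main "HOL-Computational_Algebra.Primes"
begin

text \<open>F_p is represented by the residues {0..<p} of int; functions F_p -> C by
  functions int => complex, of which only the values on {0..<p} matter.\<close>

definition ep :: "int \<Rightarrow> int \<Rightarrow> complex" where
  "ep p x = exp (- 2 * pi * \<i> * of_int x / of_int p)"

definition Kker :: "int \<Rightarrow> int \<Rightarrow> int \<Rightarrow> complex" where
  "Kker p a b = (1 / of_int p) * (\<Sum>y\<in>{0..<p}. ep p (a * y^2 + b * y))"

definition Top :: "int \<Rightarrow> (int \<Rightarrow> complex) \<Rightarrow> (int \<Rightarrow> complex) \<Rightarrow> int \<Rightarrow> complex" where
  "Top p f1 f2 s = (\<Sum>n\<in>{0..<p} - {s mod p}.
      f1 ((s - n) mod p) * f2 n * Kker p ((s - n) mod p) n)"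

definition l2norm :: "int \<Rightarrow> (int \<Rightarrow> complex) \<Rightarrow> real" where
  "l2norm p f = sqrt (\<Sum>x\<in>{0..<p}. (cmod (f x))^2)"

end

theory Submission
  imports Defs "HOL-Number_Theory.Number_Theory" "HOL-Analysis.Analysis"
begin

text \<open>
  Evaluating the Gauss sum in the kernel and expanding \<open>(s - m)^2 / m\<close> gives
  \<open>|T(f1,f2)(s)| = |W(s)| / p\<close> with \<open>W(s) = \<Sum>m g(m) f(s - m) e(- s^2 / (4m))\<close> and
  \<open>|g| \<le> sqrt p |f1|\<close>. In the square of \<open>W\<close> put \<open>m = x - k\<close>, \<open>m' = x + k\<close>, \<open>s = r + x\<close>; Cauchy-Schwarz in
  \<open>(k, r)\<close> separates \<open>f\<close> and leaves the quadratic forms with matrix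
  \<open>\<Sum>r e(D(x) (r + x)^2 - D(y) (r + y)^2)\<close> in \<open>G_k(x) = g(x - k) cnj (g(x + k))\<close>, where
  \<open>D(x) = - k / (2 (x^2 - k^2))\<close>. Up to factors depending on \<open>x\<close> or \<open>y\<close> alone, the off-diagonal entry is
  \<open>sqrt p\<close> times \<open>(x^2 - y^2 | p) e(k (y - x) / (2 (x + y)))\<close>. This depends only on \<open>y / x\<close>, so the form is a
  multiplicative convolution and is controlled by the multiplicative autocorrelations of the
  kernel and of \<open>G_k\<close>. The kernel autocorrelations are bounded on average over \<open>k\<close> by Parseval and a count
  of solutions, those of \<open>G_k\<close> by Young's inequality and \<open>|G_k|_1 \<le> |g|_2^2\<close>; no
  bound for complete exponential sums deeper than the quadratic Gauss sum is needed.
\<close>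

text \<open>Second moments are real but are expanded as complex sums; this passes from such an
  expansion to a bound by its modulus.\<close>

lemma le_cmod_of_real_eq: "complex_of_real a = z \<Longrightarrow> a \<le> cmod z"
  by (metis abs_ge_self norm_of_real)

lemma Cauchy_Schwarz_double_sum:
  fixes f g :: "'a \<Rightarrow> 'b \<Rightarrow> real"
  shows "(\<Sum>i\<in>A. \<Sum>j\<in>B. f i j * g i j)^2 \<le> (\<Sum>i\<in>A. \<Sum>j\<in>B. (f i j)^2) * (\<Sum>i\<in>A. \<Sum>j\<in>B. (g i j)^2)"
  using Cauchy_Schwarz_ineq_sum[of "\<lambda>(i, j). f i j" "\<lambda>(i, j). g i j" "A \<times> B"]
  by (simp add: sum.cartesian_product case_prod_unfold)

section \<open>Characters and Gauss sums modulo an odd prime\<close>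

locale odd_prime =
  fixes p :: int
  assumes prime_p: "prime p" and p_gt_2: "p > 2"
begin

abbreviation residues :: "int set" where "residues \<equiv> {0..<p}"

abbreviation e :: "int \<Rightarrow> complex" where "e \<equiv> ep p"

text \<open>Functions on the field are modelled as functions on all integers that are constant on
  residue classes, so that arguments such as \<open>x - k\<close> need no reduction.\<close>

definition periodic :: "(int \<Rightarrow> 'b) \<Rightarrow> bool" where
  "periodic F \<longleftrightarrow> (\<forall>x y. [x = y] (mod p) \<longrightarrow> F x = F y)"

lemma periodicD: "periodic F \<Longrightarrow> [x = y] (mod p) \<Longrightarrow> F x = F y"
  by (auto simp: periodic_def)

lemma p_pos: "p > 0"
  using p_gt_2 by simp

lemma coprime_p_iff: "coprime a p \<longleftrightarrow> \<not> p dvd a"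
  using prime_p by (metis coprime_commute prime_imp_coprime coprime_absorb_left not_prime_unit)

lemma not_dvd_2: "\<not> p dvd 2"
  using p_gt_2 zdvd_not_zless by force

lemma dvd_mult_iff: "p dvd a * b \<longleftrightarrow> p dvd a \<or> p dvd b"
  using prime_p by (rule prime_dvd_mult_iff)

lemma cong_cancel: "\<not> p dvd d \<Longrightarrow> [d * a = d * b] (mod p) \<Longrightarrow> [a = b] (mod p)"
  using cong_mult_lcancel coprime_p_iff by blast

lemma residues_eq_iff: "x \<in> residues \<Longrightarrow> y \<in> residues \<Longrightarrow> x = y \<longleftrightarrow> [x = y] (mod p)"
  using cong_less_imp_eq_int by auto

lemma inverse_exists:
  assumes "\<not> p dvd a"
  obtains b where "[a * b = 1] (mod p)" "\<not> p dvd b"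
proof -
  have c: "coprime a p" using assms by (simp add: coprime_p_iff)
  show ?thesis
    using that cong_modular_inverse1[OF c] coprime_modular_inverse[OF c] by (simp add: coprime_p_iff)
qed

lemma e_add: "e (a + b) = e a * e b"
proof -
  have "of_real (- 2 * pi) * \<i> * of_int (a + b) / of_int p
      = of_real (- 2 * pi) * \<i> * of_int a / of_int p + of_real (- 2 * pi) * \<i> * of_int b / of_int p"
    by (simp only: of_int_add distrib_left add_divide_distrib)
  then show ?thesis unfolding ep_def by (simp only: exp_add)
qed

lemma cmod_e [simp]: "cmod (e a) = 1"
  unfolding ep_def by (simp add: norm_exp)

lemma e_0 [simp]: "e 0 = 1"
  unfolding ep_def by simp

lemma e_minus: "e (- a) = cnj (e a)"
  unfolding ep_def by (simp add: exp_cnj)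

lemma e_diff: "e (a - b) = e a * cnj (e b)"
  using e_add[of a "- b"] by (simp add: e_minus)

lemma e_p: "e (p * k) = 1"
proof -
  have "- 2 * complex_of_real pi * \<i> * of_int (p * k) / of_int p = of_int (2 * (- k)) * of_real pi * \<i>"
    using p_pos by simp
  then show ?thesis
    unfolding ep_def by (simp add: exp_eq_1 exI[of _ "- k"])
qed

lemma e_eq_1_iff: "e a = 1 \<longleftrightarrow> p dvd a"
proof
  assume "e a = 1"
  then obtain n :: int where "- (2 * pi * of_int a / of_int p) = of_int (2 * n) * pi"
    unfolding ep_def exp_eq_1 by auto
  then have "pi * (- (2 * of_int a)) = pi * (2 * of_int n * of_int p)"
    using p_pos by (simp add: field_simps)
  then have "real_of_int (- a) = real_of_int (n * p)"
    unfolding mult_cancel_left by simp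
  then have "- a = n * p" by linarith
  then show "p dvd a" by (metis dvd_minus_iff dvd_triv_right)
next
  assume "p dvd a" then show "e a = 1" using e_p by auto
qed

lemma e_cong: "[a = b] (mod p) \<Longrightarrow> e a = e b"
proof -
  assume "[a = b] (mod p)"
  then have "p dvd a - b" by (simp add: cong_iff_dvd_diff)
  then have "e ((a - b) + b) = e b"
    unfolding e_add by (simp add: e_eq_1_iff[THEN iffD2])
  then show ?thesis by simp
qed

text \<open>An affine map with invertible slope is injective modulo \<open>p\<close>, and an
  injective self-map of a finite set is a permutation. All later changes of variable rest on
  this.\<close>

lemma sum_affine:
  fixes F :: "int \<Rightarrow> 'b::comm_monoid_add"
  assumes F: "periodic F" and a: "\<not> p dvd a"
  shows "(\<Sum>x\<in>residues. F (a * x + b)) = (\<Sum>x\<in>residues. F x)"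
proof -
  let ?h = "\<lambda>x. (a * x + b) mod p"
  have inj: "inj_on ?h residues"
  proof (rule inj_onI)
    fix x y assume xy: "x \<in> residues" "y \<in> residues" "?h x = ?h y"
    then have "[a * x + b = a * y + b] (mod p)" by (simp only: Cong.cong_def)
    then have "[a * x = a * y] (mod p)" by (simp only: cong_add_rcancel)
    then have "[x = y] (mod p)" using a cong_cancel by blast
    then show "x = y" using xy residues_eq_iff by blast
  qed
  have "?h ` residues \<subseteq> residues" using p_pos by auto
  then have im: "?h ` residues = residues"
    using inj by (simp add: endo_inj_surj)
  have "(\<Sum>x\<in>residues. F x) = (\<Sum>x\<in>?h ` residues. F x)" using im by simp
  also have "\<dots> = (\<Sum>x\<in>residues. F (?h x))" using inj by (simp add: sum.reindex)
  also have "\<dots> = (\<Sum>x\<in>residues. F (a * x + b))"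
    by (intro sum.cong refl periodicD[OF F]) (simp add: Cong.cong_def)
  finally show ?thesis by simp
qed

lemma sum_shift:
  fixes F :: "int \<Rightarrow> 'b::comm_monoid_add"
  shows "periodic F \<Longrightarrow> (\<Sum>x\<in>residues. F (x + b)) = (\<Sum>x\<in>residues. F x)"
  using sum_affine[of F 1 b] p_gt_2 by auto

lemma periodicI: "(\<And>x y. [x = y] (mod p) \<Longrightarrow> F x = F y) \<Longrightarrow> periodic F"
  by (auto simp: periodic_def)

lemmas cong_rules = cong_refl cong_add cong_diff cong_mult cong_pow cong_uminus

text \<open>Shifting \<open>x\<close> by one multiplies the sum by \<open>e a\<close>, which differs
  from 1 unless \<open>p\<close> divides \<open>a\<close>.\<close>

lemma sum_e_linear: "(\<Sum>x\<in>residues. e (a * x)) = (if p dvd a then of_int p else 0)"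
proof (cases "p dvd a")
  case True
  then have "e (a * x) = 1" for x by (simp add: e_eq_1_iff)
  then show ?thesis using True p_pos by simp
next
  case False
  have "(\<Sum>x\<in>residues. e (a * x)) = (\<Sum>x\<in>residues. e (a * (x + 1)))"
    by (rule sum_shift[symmetric]) (auto intro!: periodicI e_cong cong_rules)
  also have "\<dots> = e a * (\<Sum>x\<in>residues. e (a * x))"
    by (simp add: distrib_left e_add sum_distrib_left mult.commute)
  finally show ?thesis using False e_eq_1_iff[of a] by auto
qed

section \<open>Quadratic Gauss sums and the Legendre symbol\<close>

definition gauss :: "int \<Rightarrow> complex" where
  "gauss a = (\<Sum>x\<in>residues. e (a * x^2))"

abbreviation Leg :: "int \<Rightarrow> int" where "Leg a \<equiv> Legendre a p"

lemma Leg_cong: "[a = b] (mod p) \<Longrightarrow> Leg a = Leg b"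
proof -
  assume ab: "[a = b] (mod p)"
  have "[a = 0] (mod p) \<longleftrightarrow> [b = 0] (mod p)"
    using ab by (simp add: Cong.cong_def)
  moreover have "[y^2 = a] (mod p) \<longleftrightarrow> [y^2 = b] (mod p)" for y
    using ab by (simp add: Cong.cong_def)
  ultimately show ?thesis by (simp add: Legendre_def QuadRes_def)
qed

lemma abs_Leg: "\<not> p dvd a \<Longrightarrow> \<bar>Leg a\<bar> = 1"
  unfolding Legendre_def by (simp add: cong_0_iff)

lemma Leg_eq_0: "p dvd a \<Longrightarrow> Leg a = 0"
  unfolding Legendre_def by (simp add: cong_0_iff)

text \<open>Euler's criterion gives the identity modulo \<open>p\<close>; the two sides differ by at
  most 2, which is less than \<open>p\<close>, so the congruence is an equality.\<close>

lemma Leg_mult: "Leg (a * b) = Leg a * Leg b"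
proof (cases "p dvd a * b")
  case True
  then show ?thesis using Leg_eq_0 dvd_mult_iff by (metis mult_zero_left mult_zero_right)
next
  case False
  have eul: "[Leg c = c ^ ((nat p - 1) div 2)] (mod p)" for c
  proof -
    have "prime (nat p)" "2 < nat p" "int (nat p) = p" using prime_p p_gt_2 by auto
    then show ?thesis using euler_criterion[of "nat p" c] by simp
  qed
  have "[Leg (a * b) = Leg a * Leg b] (mod p)"
    using cong_trans[OF eul[of "a * b"]] cong_mult[OF eul[of a] eul[of b]]
    by (metis cong_sym power_mult_distrib)
  then have "p dvd Leg (a * b) - Leg a * Leg b" by (simp add: cong_iff_dvd_diff)
  moreover have "\<bar>Leg (a * b) - Leg a * Leg b\<bar> < p"
    using abs_Leg[of a] abs_Leg[of b] abs_Leg[OF False] False p_gt_2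
    by (auto simp: dvd_mult_iff abs_if split: if_splits)
  ultimately show ?thesis
    by (metis dvd_imp_le_int abs_of_pos eq_iff_diff_eq_0 linorder_not_le p_pos)
qed

text \<open>A multiple of \<open>p\<close> has the single root 0; a nonzero square has the roots
  \<open>y\<close> and \<open>p - y\<close>, distinct because \<open>p\<close> is odd. The count
  turns a sum over squares into a character sum.\<close>

lemma card_square_roots: "int (card {x\<in>residues. [x^2 = a] (mod p)}) = 1 + Leg a"
proof (cases "p dvd a")
  case True
  have "{x\<in>residues. [x^2 = a] (mod p)} = {0}"
  proof -
    have "x = 0" if "x \<in> residues" "[x^2 = a] (mod p)" for x
    proof -
      have "p dvd x^2" using that True cong_dvd_iff by blast
      then have "p dvd x" using prime_p prime_dvd_power by blast
      then show ?thesis using that zdvd_imp_le by fastforce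
    qed
    moreover have "[0^2 = a] (mod p)" using True by (simp add: cong_iff_dvd_diff)
    ultimately show ?thesis using p_pos by auto
  qed
  then show ?thesis using True Leg_eq_0 by simp
next
  case False
  show ?thesis
  proof (cases "QuadRes p a")
    case True
    then obtain y0 where y0: "[y0^2 = a] (mod p)" by (auto simp: QuadRes_def)
    define y where "y = y0 mod p"
    have y: "[y^2 = a] (mod p)" "y \<in> residues"
      using y0 p_pos unfolding y_def by (auto simp: Cong.cong_def power_mod)
    have ny: "\<not> p dvd y" using cong_dvd_iff[OF y(1)] False by (simp add: power2_eq_square dvd_mult_iff)
    then have y_pos: "y > 0" using y(2) by (metis atLeastLessThan_iff dvd_0_right order_le_less)
    have "{x\<in>residues. [x^2 = a] (mod p)} = {y, p - y}"
    proof (intro equalityI subsetI)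
      fix x assume "x \<in> {x\<in>residues. [x^2 = a] (mod p)}"
      then have x: "x \<in> residues" "[x^2 = a] (mod p)" by auto
      have "[x^2 = y^2] (mod p)" using x(2) cong_sym[OF y(1)] by (rule cong_trans)
      then have "p dvd (x - y) * (x + y)"
        by (simp add: cong_iff_dvd_diff power2_eq_square algebra_simps)
      then have "p dvd x - y \<or> p dvd x + y"
        by (simp only: dvd_mult_iff)
      then show "x \<in> {y, p - y}"
      proof
        assume "p dvd x - y"
        then have "x = y" using x(1) y(2) by (simp only: residues_eq_iff cong_iff_dvd_diff)
        then show ?thesis by simp
      next
        assume "p dvd x + y"
        then have "p dvd (x + y) - p" by simp
        then have "[x = p - y] (mod p)" by (simp add: cong_iff_dvd_diff algebra_simps)
        moreover have "p - y \<in> residues" using y y_pos by auto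
        ultimately have "x = p - y" using x residues_eq_iff by blast
        then show ?thesis using x by simp
      qed
    next
      fix x assume x: "x \<in> {y, p - y}"
      have "[(p - y)^2 = y^2] (mod p)"
        unfolding cong_iff_dvd_diff by (simp add: power2_eq_square algebra_simps)
      then have py: "[(p - y)^2 = a] (mod p)" using y(1) by (rule cong_trans)
      show "x \<in> {x\<in>residues. [x^2 = a] (mod p)}" using x py y y_pos by auto
    qed
    moreover have "y \<noteq> p - y"
    proof
      assume "y = p - y"
      then have "p dvd 2 * y" by simp
      then show False using ny not_dvd_2 dvd_mult_iff by blast
    qed
    ultimately have "card {x\<in>residues. [x^2 = a] (mod p)} = 2" by simp
    moreover have "Leg a = 1" using True False by (simp add: Legendre_def cong_0_iff)
    ultimately show ?thesis by simp
  next
    case f: False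
    then have "{x\<in>residues. [x^2 = a] (mod p)} = {}" by (auto simp: QuadRes_def)
    moreover have "Leg a = -1" using f False by (simp add: Legendre_def cong_0_iff)
    ultimately show ?thesis by (metis add.right_inverse card.empty of_nat_0)
  qed
qed

text \<open>Sorting the terms by \<open>u = x^2\<close> gives each \<open>u\<close> the weight
  \<open>1 + Leg u\<close>; the constant part of the weight sums to zero by orthogonality.\<close>

lemma gauss_eq_Leg_sum:
  assumes "\<not> p dvd a"
  shows "gauss a = (\<Sum>u\<in>residues. of_int (Leg u) * e (a * u))"
proof -
  have "gauss a = (\<Sum>x\<in>residues. \<Sum>u\<in>residues. if [x^2 = u] (mod p) then e (a * u) else 0)"
  proof -
    have "e (a * x^2) = (\<Sum>u\<in>residues. if [x^2 = u] (mod p) then e (a * u) else 0)" for x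
    proof -
      have "(\<Sum>u\<in>residues. if [x^2 = u] (mod p) then e (a * u) else 0)
          = (\<Sum>u\<in>residues. if u = x^2 mod p then e (a * u) else 0)"
        by (intro sum.cong if_cong refl) (auto simp: Cong.cong_def)
      also have "\<dots> = e (a * (x^2 mod p))" using p_pos by simp
      also have "\<dots> = e (a * x^2)" by (intro e_cong cong_rules) (simp add: Cong.cong_def)
      finally show ?thesis by simp
    qed
    then show ?thesis unfolding gauss_def by simp
  qed
  also have "\<dots> = (\<Sum>u\<in>residues. \<Sum>x\<in>residues. if [x^2 = u] (mod p) then e (a * u) else 0)"
    by (rule sum.swap)
  also have "\<dots> = (\<Sum>u\<in>residues. of_int (1 + Leg u) * e (a * u))"
  proof (intro sum.cong refl)
    fix u
    have "(\<Sum>x\<in>residues. if [x^2 = u] (mod p) then e (a * u) else 0)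
        = of_nat (card {x\<in>residues. [x^2 = u] (mod p)}) * e (a * u)"
      by (simp add: sum.If_cases Int_def sum_constant)
    also have "of_nat (card {x\<in>residues. [x^2 = u] (mod p)}) = (of_int (1 + Leg u) :: complex)"
      unfolding card_square_roots[symmetric] by simp
    finally show "(\<Sum>x\<in>residues. if [x^2 = u] (mod p) then e (a * u) else 0)
        = of_int (1 + Leg u) * e (a * u)" .
  qed
  also have "\<dots> = (\<Sum>u\<in>residues. e (a * u)) + (\<Sum>u\<in>residues. of_int (Leg u) * e (a * u))"
    by (simp add: distrib_right sum.distrib)
  finally show ?thesis using assms by (simp add: sum_e_linear)
qed

text \<open>In the character sum, insert \<open>Leg a * Leg a = 1\<close> and substitute
  \<open>v = a * u\<close>.\<close>

lemma gauss_Leg: 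
  assumes "\<not> p dvd a"
  shows "gauss a = of_int (Leg a) * gauss 1"
proof -
  have sq: "Leg a * Leg a = 1" using abs_Leg[OF assms] by (auto simp: abs_if split: if_splits)
  have "gauss a = (\<Sum>u\<in>residues. of_int (Leg a) * (of_int (Leg (a * u)) * e (a * u)))"
    unfolding gauss_eq_Leg_sum[OF assms] Leg_mult
    by (intro sum.cong refl) (simp add: mult.assoc[symmetric] sq of_int_mult[symmetric] del: of_int_mult)
  also have "\<dots> = of_int (Leg a) * (\<Sum>u\<in>residues. (\<lambda>v. of_int (Leg v) * e v) (a * u + 0))"
    by (simp add: sum_distrib_left)
  also have "(\<Sum>u\<in>residues. (\<lambda>v. of_int (Leg v) * e v) (a * u + 0)) = (\<Sum>v\<in>residues. of_int (Leg v) * e v)"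
    using assms by (intro sum_affine periodicI) (auto simp: e_cong Leg_cong)
  finally show ?thesis using gauss_eq_Leg_sum[of 1] prime_p not_prime_unit by auto
qed

text \<open>Completing the square with \<open>b = B / (2 A)\<close> leaves the constant term
  \<open>C - B^2 / (4 A)\<close>. The hypothesis on \<open>c\<close> states this value with
  denominators cleared, so callers need not handle inverses.\<close>

lemma gauss_quadratic:
  assumes A: "\<not> p dvd A" and c: "[4 * A * c = 4 * A * C - B^2] (mod p)"
  shows "(\<Sum>x\<in>residues. e (A * x^2 + B * x + C)) = gauss A * e c"
proof -
  have n2A: "\<not> p dvd 2 * A" using A not_dvd_2 dvd_mult_iff by blast
  obtain i where i: "[2 * A * i = 1] (mod p)" using inverse_exists[OF n2A] by blast
  define b where "b = B * i"
  have b: "[2 * A * b = B] (mod p)"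
    using cong_scalar_left[OF i, of B] by (simp add: b_def algebra_simps)
  have "[2 * A * (2 * c) = 2 * A * (2 * (C - A * b^2))] (mod p)"
  proof -
    have "[4 * A * c = 4 * A * C - (2 * A * b)^2] (mod p)"
      using c cong_diff[OF cong_refl cong_pow[OF cong_sym[OF b]]] by (rule cong_trans)
    then show ?thesis by (simp add: algebra_simps power2_eq_square)
  qed
  then have "[2 * c = 2 * (C - A * b^2)] (mod p)" using n2A cong_cancel by blast
  then have c': "[c = C - A * b^2] (mod p)" using not_dvd_2 cong_cancel by blast
  have "(\<Sum>x\<in>residues. e (A * x^2 + B * x + C)) = (\<Sum>x\<in>residues. e (A * (x + b)^2) * e c)"
  proof (intro sum.cong refl)
    fix x
    have "[A * x^2 + B * x + C = A * (x + b)^2 + c] (mod p)"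
    proof -
      have "[A * x^2 + B * x + C = A * x^2 + 2 * A * b * x + (c + A * b^2)] (mod p)"
        using cong_add[OF c' cong_refl[of "A * b^2"]]
        by (intro cong_add cong_mult cong_refl cong_sym[OF b]) (simp add: cong_sym_eq)
      then show ?thesis by (simp add: algebra_simps power2_eq_square)
    qed
    then show "e (A * x^2 + B * x + C) = e (A * (x + b)^2) * e c"
      by (metis e_cong e_add)
  qed
  also have "\<dots> = (\<Sum>x\<in>residues. e (A * (x + b)^2)) * e c" by (simp add: sum_distrib_right)
  also have "(\<Sum>x\<in>residues. e (A * (x + b)^2)) = gauss A" unfolding gauss_def
    by (rule sum_shift) (auto intro!: periodicI e_cong cong_rules)
  finally show ?thesis .
qed

text \<open>In the expanded square, replacing \<open>x\<close> by \<open>x + y\<close> makes the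
  exponent linear in \<open>y\<close>; orthogonality then leaves only \<open>x = 0\<close>.\<close>

lemma cmod_gauss:
  assumes "\<not> p dvd a"
  shows "(cmod (gauss a))^2 = of_int p"
proof -
  have "complex_of_real ((cmod (gauss a))^2) = gauss a * cnj (gauss a)"
    by (rule complex_norm_square)
  also have "\<dots> = (\<Sum>y\<in>residues. \<Sum>x\<in>residues. e (a * x^2 - a * y^2))"
    unfolding gauss_def cnj_sum sum_product e_diff by (rule sum.swap)
  also have "\<dots> = (\<Sum>y\<in>residues. \<Sum>x\<in>residues. e (a * (x + y)^2 - a * y^2))"
    by (intro sum.cong refl sum_shift[symmetric]) (auto intro!: periodicI e_cong cong_rules)
  also have "\<dots> = (\<Sum>x\<in>residues. \<Sum>y\<in>residues. e (a * x^2) * e ((2 * a * x) * y))"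
    by (subst sum.swap) (simp add: e_add[symmetric] algebra_simps power2_eq_square)
  also have "\<dots> = (\<Sum>x\<in>residues. e (a * x^2) * (if p dvd 2 * a * x then of_int p else 0))"
    by (simp only: sum_distrib_left[symmetric] sum_e_linear)
  also have "\<dots> = (\<Sum>x\<in>residues. if x = 0 then of_int p else 0)"
  proof (intro sum.cong refl)
    fix x assume "x \<in> residues"
    then have "p dvd 2 * a * x \<longleftrightarrow> x = 0"
      using assms not_dvd_2 by (auto simp: dvd_mult_iff dest: zdvd_imp_le)
    then show "e (a * x^2) * (if p dvd 2 * a * x then of_int p else 0) = (if x = 0 then of_int p else 0)"
      by auto
  qed
  also have "\<dots> = of_int p" using p_pos by simp
  finally show ?thesis by (metis of_real_of_int_eq of_real_eq_iff)
qed

section \<open>The homogeneous kernel\<close>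

lemma inverse_cong:
  assumes "[a = b] (mod p)" shows "modular_inverse p a = modular_inverse p b"
proof (cases "p dvd a")
  \<comment> \<open>Both inverses take the default value when \<open>p\<close> divides the
    argument.\<close>
  case True
  then have "p dvd b" using cong_dvd_iff[OF assms] by simp
  then show ?thesis using True by (simp add: modular_inverse_def coprime_p_iff coprime_commute)
next
  case False
  then have b: "coprime b p" using cong_dvd_iff[OF assms] by (simp add: coprime_p_iff)
  have "[a * modular_inverse p b = b * modular_inverse p b] (mod p)"
    using assms by (rule cong_scalar_right)
  then have "[a * modular_inverse p b = 1] (mod p)"
    using cong_modular_inverse1[OF b] by (rule cong_trans)
  then show ?thesis
    using p_pos by (intro modular_inverse_int_eqI) (auto simp: modular_inverse_int_nonneg modular_inverse_int_less)
qed

text \<open>The fraction \<open>(y - x) / (2 (x + y))\<close> modulo \<open>p\<close>. Its value for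
  \<open>p\<close> dividing \<open>x + y\<close> is immaterial in \<open>ker\<close>, where the
  character factor vanishes.\<close>

definition ratio :: "int \<Rightarrow> int \<Rightarrow> int" where
  "ratio x y = (y - x) * modular_inverse p (2 * (x + y))"

lemma ratio:
  assumes "\<not> p dvd x + y"
  shows "[2 * (x + y) * ratio x y = y - x] (mod p)"
proof -
  have "coprime (2 * (x + y)) p"
    unfolding coprime_p_iff dvd_mult_iff using not_dvd_2 assms by simp
  then have "[(y - x) * (2 * (x + y) * modular_inverse p (2 * (x + y))) = (y - x) * 1] (mod p)"
    by (intro cong_scalar_left cong_modular_inverse1)
  then show ?thesis by (simp add: ratio_def mult_ac)
qed

lemma ratio_cong:
  assumes "[x = x'] (mod p)" "[y = y'] (mod p)"
  shows "[ratio x y = ratio x' y'] (mod p)"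
proof -
  have "modular_inverse p (2 * (x + y)) = modular_inverse p (2 * (x' + y'))"
    using assms by (intro inverse_cong cong_rules)
  then show ?thesis
    unfolding ratio_def using assms by (metis cong_diff cong_scalar_right)
qed

abbreviation chi :: "int \<Rightarrow> complex" where "chi a \<equiv> of_int (Leg a)"

lemma cmod_chi_le: "cmod (chi a) \<le> 1"
proof -
  have "\<bar>Leg a\<bar> \<le> 1" using abs_Leg[of a] Leg_eq_0[of a] by (cases "p dvd a") auto
  then have "real_of_int \<bar>Leg a\<bar> \<le> 1" by linarith
  then show ?thesis by simp
qed

definition ker :: "int \<Rightarrow> int \<Rightarrow> int \<Rightarrow> complex" where
  "ker k x y = chi (x^2 - y^2) * e (k * ratio x y)"

lemma cmod_ker_le: "cmod (ker k x y) \<le> 1"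
  using cmod_chi_le[of "x^2 - y^2"] by (simp add: ker_def norm_mult del: norm_of_int)

lemma ker_cong:
  assumes "[x = x'] (mod p)" "[y = y'] (mod p)"
  shows "ker k x y = ker k x' y'"
proof -
  have "Leg (x^2 - y^2) = Leg (x'^2 - y'^2)" using assms by (intro Leg_cong cong_rules)
  moreover have "e (k * ratio x y) = e (k * ratio x' y')"
    using assms by (intro e_cong cong_scalar_left ratio_cong)
  ultimately show ?thesis by (simp add: ker_def)
qed

lemma ker_eq_0: "p dvd x^2 - y^2 \<Longrightarrow> ker k x y = 0"
  by (simp add: ker_def Leg_eq_0)

lemma dvd_diff_squares_iff: "p dvd x^2 - y^2 \<longleftrightarrow> p dvd x - y \<or> p dvd x + y"
proof -
  have "x^2 - y^2 = (x - y) * (x + y)" by (simp add: power2_eq_square algebra_simps)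
  then show ?thesis by (simp only: dvd_mult_iff)
qed

text \<open>Homogeneity of degree zero: the character argument gains the square \<open>u^2\<close>
  and the fraction is unchanged. This makes the form a multiplicative convolution.\<close>

lemma ker_scale:
  assumes u: "\<not> p dvd u"
  shows "ker k (u * x) (u * y) = ker k x y"
proof (cases "p dvd x^2 - y^2")
  case True
  have "(u * x)^2 - (u * y)^2 = u^2 * (x^2 - y^2)" by (simp add: power2_eq_square algebra_simps)
  then have "p dvd (u * x)^2 - (u * y)^2" using True by simp
  then show ?thesis using True ker_eq_0 by simp
next
  case False
  then have xy: "\<not> p dvd x + y" using dvd_diff_squares_iff by blast
  have uxy: "\<not> p dvd u * x + u * y" 
    using xy u dvd_mult_iff by (simp flip: distrib_left)
  have "Leg ((u * x)^2 - (u * y)^2) = Leg u * Leg u * Leg (x^2 - y^2)"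
    unfolding Leg_mult[symmetric] by (simp add: power2_eq_square algebra_simps)
  moreover have "Leg u * Leg u = 1" using abs_Leg[OF u] by (auto simp: abs_if split: if_splits)
  moreover have "[ratio (u * x) (u * y) = ratio x y] (mod p)"
  proof -
    have "[2 * (u * x + u * y) * ratio (u * x) (u * y) = u * y - u * x] (mod p)" 
      using uxy by (rule ratio)
    also have "[u * y - u * x = 2 * (u * x + u * y) * ratio x y] (mod p)"
      using cong_scalar_left[OF ratio[OF xy], of u] by (simp add: cong_sym_eq algebra_simps)
    finally show ?thesis
      using cong_cancel uxy not_dvd_2 dvd_mult_iff by blast
  qed
  ultimately show ?thesis
    unfolding ker_def using e_cong[OF cong_scalar_left] by simp
qed

section \<open>The multiplicative group and averages of the kernel autocorrelations\<close>

abbreviation units :: "int set" where "units \<equiv> {1..<p}"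

lemma units_not_dvd: "x \<in> units \<Longrightarrow> \<not> p dvd x"
  using zdvd_not_zless by auto

lemma units_eq: "units = {x\<in>residues. \<not> p dvd x}"
  using units_not_dvd by (auto simp: le_less int_one_le_iff_zero_less)

lemma residues_insert: "residues = insert 0 units"
  using p_pos by auto

text \<open>Extended by zero to the multiples of \<open>p\<close>, the summand stays periodic, so
  this is a case of \<open>sum_affine\<close>.\<close>

lemma sum_units_scale:
  fixes F :: "int \<Rightarrow> 'b::comm_monoid_add"
  assumes F: "periodic F" and a: "\<not> p dvd a"
  shows "(\<Sum>x\<in>units. F (a * x)) = (\<Sum>x\<in>units. F x)"
proof -
  define F' where "F' x = (if p dvd x then 0 else F x)" for x
  have "periodic F'"
    using F unfolding F'_def periodic_def by (metis cong_dvd_iff)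
  then have "(\<Sum>x\<in>residues. F' (a * x + 0)) = (\<Sum>x\<in>residues. F' x)" using a by (rule sum_affine)
  moreover have "(\<Sum>x\<in>residues. F' (a * x + 0)) = (\<Sum>x\<in>units. F (a * x))"
    unfolding units_eq using a
    by (intro sum.mono_neutral_cong_right) (auto simp: F'_def dvd_mult_iff)
  moreover have "(\<Sum>x\<in>residues. F' x) = (\<Sum>x\<in>units. F x)"
    unfolding units_eq by (intro sum.mono_neutral_cong_right) (auto simp: F'_def)
  ultimately show ?thesis by simp
qed

text \<open>After expanding the square, orthogonality in \<open>k\<close> keeps only the pairs with
  equal frequencies; each contributes at most \<open>p\<close> in modulus.\<close>

lemma parseval_count_le:
  fixes a :: "int \<Rightarrow> complex" and \<omega> :: "int \<Rightarrow> int"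
  assumes "finite Y" "\<And>y. y \<in> Y \<Longrightarrow> cmod (a y) \<le> 1"
  shows "(\<Sum>k\<in>residues. (cmod (\<Sum>y\<in>Y. a y * e (k * \<omega> y)))^2)
    \<le> of_int p * of_nat (card {(y, z). y \<in> Y \<and> z \<in> Y \<and> [\<omega> y = \<omega> z] (mod p)})"
proof -
  have "complex_of_real (\<Sum>k\<in>residues. (cmod (\<Sum>y\<in>Y. a y * e (k * \<omega> y)))^2)
    = (\<Sum>k\<in>residues. \<Sum>y\<in>Y. \<Sum>z\<in>Y. a y * cnj (a z) * e ((\<omega> y - \<omega> z) * k))"
    unfolding of_real_sum complex_norm_square cnj_sum sum_product
  proof (intro sum.cong refl)
    fix k y z
    have "e ((\<omega> y - \<omega> z) * k) = e (k * \<omega> y) * cnj (e (k * \<omega> z))"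
      by (simp add: algebra_simps flip: e_diff)
    then show "a y * e (k * \<omega> y) * cnj (a z * e (k * \<omega> z)) = a y * cnj (a z) * e ((\<omega> y - \<omega> z) * k)"
      by simp
  qed
  also have "\<dots> = (\<Sum>y\<in>Y. \<Sum>z\<in>Y. a y * cnj (a z) * (\<Sum>k\<in>residues. e ((\<omega> y - \<omega> z) * k)))"
    by (simp only: sum.swap[of _ _ residues] sum_distrib_left)
  also have "\<dots> = (\<Sum>(y, z)\<in>Y \<times> Y. if [\<omega> y = \<omega> z] (mod p) then a y * cnj (a z) * of_int p else 0)"
    unfolding sum.cartesian_product sum_e_linear by (intro sum.cong) (auto simp: cong_iff_dvd_diff)
  also have "\<dots> = (\<Sum>(y, z)\<in>{(y, z). y \<in> Y \<and> z \<in> Y \<and> [\<omega> y = \<omega> z] (mod p)}. a y * cnj (a z) * of_int p)"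
    using assms(1) by (intro sum.mono_neutral_cong_right) (auto split: if_splits)
  finally have "(\<Sum>k\<in>residues. (cmod (\<Sum>y\<in>Y. a y * e (k * \<omega> y)))^2)
    \<le> cmod (\<Sum>(y, z)\<in>{(y, z). y \<in> Y \<and> z \<in> Y \<and> [\<omega> y = \<omega> z] (mod p)}. a y * cnj (a z) * of_int p)"
    by (rule le_cmod_of_real_eq)
  also have "\<dots> \<le> of_nat (card {(y, z). y \<in> Y \<and> z \<in> Y \<and> [\<omega> y = \<omega> z] (mod p)}) * of_int p"
    using p_pos assms(2) by (intro sum_norm_bound) (auto simp: norm_mult intro!: mult_le_one)
  finally show ?thesis by (simp add: mult.commute)
qed

text \<open>By homogeneity this is the inner product of the kernel rows at \<open>x\<close> and
  \<open>x * v\<close> for every unit \<open>x\<close>, so it is the multiplicative autocorrelation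
  of the kernel.\<close>

definition corr :: "int \<Rightarrow> int \<Rightarrow> complex" where
  "corr k v = (\<Sum>y\<in>residues. ker k 1 y * cnj (ker k v y))"

lemma cmod_corr_le: "cmod (corr k v) \<le> of_int p"
proof -
  have "cmod (corr k v) \<le> of_nat (card residues) * 1"
    unfolding corr_def
    by (rule sum_norm_bound) (simp add: norm_mult mult_le_one cmod_ker_le)
  then show ?thesis using p_pos by simp
qed

text \<open>Over the common denominator \<open>2 (1 + y) (v + y)\<close> the numerator is
  \<open>(y - 1) (v + y) - (y - v) (1 + y) = 2 y (v - 1)\<close>.\<close>

lemma ratio_diff:
  assumes "\<not> p dvd 1 + y" "\<not> p dvd v + y"
  shows "[(1 + y) * (v + y) * (ratio 1 y - ratio v y) = y * (v - 1)] (mod p)"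
proof -
  have "[(v + y) * (2 * (1 + y) * ratio 1 y) - (1 + y) * (2 * (v + y) * ratio v y)
        = (v + y) * (y - 1) - (1 + y) * (y - v)] (mod p)"
    using assms by (intro cong_diff cong_scalar_left ratio)
  then have "[2 * ((1 + y) * (v + y) * (ratio 1 y - ratio v y)) = 2 * (y * (v - 1))] (mod p)"
    by (simp add: algebra_simps)
  then show ?thesis using not_dvd_2 cong_cancel by blast
qed

text \<open>After clearing denominators the equation factors as \<open>(v - 1) (z - y) (y z - v) = 0\<close>.\<close>

lemma ratio_diff_eq:
  assumes v: "\<not> p dvd v - 1"
    and y: "\<not> p dvd 1 + y" "\<not> p dvd v + y" and z: "\<not> p dvd 1 + z" "\<not> p dvd v + z"
    and eq: "[ratio 1 y - ratio v y = ratio 1 z - ratio v z] (mod p)"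
  shows "[z = y] (mod p) \<or> [y * z = v] (mod p)"
proof -
  let ?Dy = "(1 + y) * (v + y)" and ?Dz = "(1 + z) * (v + z)"
  have "[?Dz * (y * (v - 1)) = ?Dz * (?Dy * (ratio 1 y - ratio v y))] (mod p)"
    by (intro cong_scalar_left cong_sym[OF ratio_diff] y)
  also have "[?Dz * (?Dy * (ratio 1 y - ratio v y)) = ?Dz * (?Dy * (ratio 1 z - ratio v z))] (mod p)"
    by (intro cong_scalar_left eq)
  also have "?Dz * (?Dy * (ratio 1 z - ratio v z)) = ?Dy * (?Dz * (ratio 1 z - ratio v z))"
    by (simp add: mult_ac)
  also have "[?Dy * (?Dz * (ratio 1 z - ratio v z)) = ?Dy * (z * (v - 1))] (mod p)"
    by (intro cong_scalar_left ratio_diff z)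
  finally have "p dvd (v - 1) * ((z - y) * (y * z - v))"
    by (simp add: cong_iff_dvd_diff algebra_simps)
  then show ?thesis using v by (simp add: dvd_mult_iff cong_iff_dvd_diff)
qed

text \<open>As a function of \<open>k\<close>, the autocorrelation has the frequencies
  \<open>ratio 1 y - ratio v y\<close>. Two of them agree only for \<open>z = y\<close> or
  \<open>z = v / y\<close>, which gives at most \<open>2 p\<close> pairs in the Parseval
  count.\<close>

lemma sum_corr_le:
  assumes v: "\<not> p dvd v - 1" "\<not> p dvd v"
  shows "(\<Sum>k\<in>residues. (cmod (corr k v))^2) \<le> 2 * of_int p^2"
proof -
  \<comment> \<open>Outside \<open>Y\<close> one of the two kernel factors vanishes; inside it both
    fractions have invertible denominators.\<close>
  define Y where "Y = {y\<in>residues. \<not> p dvd 1^2 - y^2 \<and> \<not> p dvd v^2 - y^2}"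
  define P where "P = {(y, z). y \<in> Y \<and> z \<in> Y \<and> [ratio 1 y - ratio v y = ratio 1 z - ratio v z] (mod p)}"
  have "corr k v = (\<Sum>y\<in>Y. chi (1^2 - y^2) * chi (v^2 - y^2) * e (k * (ratio 1 y - ratio v y)))" for k
  proof -
    have "corr k v = (\<Sum>y\<in>Y. ker k 1 y * cnj (ker k v y))"
      unfolding corr_def Y_def
      by (intro sum.mono_neutral_right) (auto simp: ker_eq_0)
    then show ?thesis by (simp add: ker_def right_diff_distrib e_diff mult_ac)
  qed
  moreover have "finite Y"
    by (rule finite_subset[of _ residues]) (auto simp: Y_def)
  moreover have "cmod (chi (1^2 - y^2) * chi (v^2 - y^2)) \<le> 1" for y
    unfolding norm_mult by (intro mult_le_one cmod_chi_le norm_ge_zero)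
  ultimately have "(\<Sum>k\<in>residues. (cmod (corr k v))^2) \<le> of_int p * of_nat (card P)"
    unfolding P_def by (simp only: parseval_count_le)
  also have "card P \<le> 2 * nat p"
  proof -
    \<comment> \<open>\<open>?i y\<close> is the second solution \<open>v / y\<close>, so the pairs
      lie on the diagonal or on the hyperbola \<open>y z = v\<close>.\<close>
    let ?i = "\<lambda>y. (v * modular_inverse p y) mod p"
    have "P \<subseteq> (\<lambda>y. (y, y)) ` residues \<union> (\<lambda>y. (y, ?i y)) ` residues"
    proof (intro subrelI, rule ccontr)
      fix y z assume yz: "(y, z) \<in> P" and "(y, z) \<notin> (\<lambda>y. (y, y)) ` residues \<union> (\<lambda>y. (y, ?i y)) ` residues"
      then have ne: "y \<noteq> z" "z \<noteq> ?i y" and res: "y \<in> residues" "z \<in> residues"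
        by (auto simp: P_def Y_def)
      have "[z = y] (mod p) \<or> [y * z = v] (mod p)"
        using yz v by (intro ratio_diff_eq) (auto simp: P_def Y_def dvd_diff_squares_iff simp del: power_one)
      moreover have "\<not> [z = y] (mod p)" using ne res residues_eq_iff by blast
      ultimately have yzv: "[y * z = v] (mod p)" by blast
      then have "\<not> p dvd y" using v cong_dvd_iff dvd_mult2 by blast
      then have c: "coprime y p" by (simp add: coprime_p_iff)
      have "[z = (modular_inverse p y * y) * z] (mod p)"
        using cong_scalar_right[OF cong_sym[OF cong_modular_inverse2[OF c]], of z] by simp
      also have "(modular_inverse p y * y) * z = modular_inverse p y * (y * z)" by simp
      also have "[\<dots> = modular_inverse p y * v] (mod p)" using yzv by (rule cong_scalar_left)
      also have "[modular_inverse p y * v = ?i y] (mod p)" by (simp add: mult.commute)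
      finally have "[z = ?i y] (mod p)" .
      moreover have "?i y \<in> residues" using p_pos by simp
      ultimately show False using ne res residues_eq_iff by blast
    qed
    then have "card P \<le> card ((\<lambda>y. (y, y)) ` residues \<union> (\<lambda>y. (y, ?i y)) ` residues)"
      by (intro card_mono finite_UnI finite_imageI finite_atLeastLessThan_int)
    also have "\<dots> \<le> card ((\<lambda>y. (y, y)) ` residues) + card ((\<lambda>y. (y, ?i y)) ` residues)"
      by (rule card_Un_le)
    also have "\<dots> \<le> card residues + card residues" by (intro add_mono card_image_le) auto
    finally show ?thesis by simp
  qed
  then have "real_of_int p * of_nat (card P) \<le> of_int p * (2 * of_int p)"
    using p_pos by (intro mult_left_mono) (simp_all add: of_nat_le_iff[symmetric, where 'a=real] del: of_nat_le_iff)
  finally show ?thesis by (simp add: power2_eq_square)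
qed

text \<open>At \<open>v = 1\<close> the frequencies all vanish and only the trivial bound
  \<open>p\<close> is available, costing \<open>p^3\<close> in total; the other fewer than
  \<open>p\<close> values of \<open>v\<close> cost \<open>2 p^2\<close> each.\<close>

lemma sum_sum_corr_le: "(\<Sum>k\<in>residues. \<Sum>v\<in>units. (cmod (corr k v))^2) \<le> 3 * of_int p^3"
proof -
  have one: "1 \<in> units" using p_gt_2 by simp
  have "(\<Sum>k\<in>residues. \<Sum>v\<in>units. (cmod (corr k v))^2) = (\<Sum>v\<in>units. \<Sum>k\<in>residues. (cmod (corr k v))^2)"
    by (rule sum.swap)
  also have "\<dots> = (\<Sum>k\<in>residues. (cmod (corr k 1))^2) + (\<Sum>v\<in>units - {1}. \<Sum>k\<in>residues. (cmod (corr k v))^2)"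
    using one by (intro sum.remove) auto
  also have "(\<Sum>k\<in>residues. (cmod (corr k 1))^2) \<le> of_nat (card residues) * of_int p^2"
    by (rule sum_bounded_above) (simp add: power_mono cmod_corr_le)
  also have "(\<Sum>v\<in>units - {1}. \<Sum>k\<in>residues. (cmod (corr k v))^2) \<le> of_nat (card (units - {1})) * (2 * of_int p^2)"
  proof (rule sum_bounded_above)
    fix v assume v: "v \<in> units - {1}"
    then have "v - 1 \<in> units" by auto
    then show "(\<Sum>k\<in>residues. (cmod (corr k v))^2) \<le> 2 * of_int p^2"
      using v units_not_dvd by (intro sum_corr_le) auto
  qed
  also have "real (card (units - {1})) * (2 * of_int p^2) \<le> of_int p * (2 * of_int p^2)"
  proof (intro mult_right_mono)
    have "card (units - {1}) \<le> nat p"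
      using card_mono[of units "units - {1}"] by simp
    then show "real (card (units - {1})) \<le> of_int p" using p_pos by linarith
  qed simp
  finally show ?thesis using p_pos by (simp add: power3_eq_cube power2_eq_square)
qed

section \<open>The bilinear form of the kernel\<close>

definition mult_corr :: "(int \<Rightarrow> complex) \<Rightarrow> int \<Rightarrow> complex" where
  "mult_corr H v = (\<Sum>x\<in>units. H x * cnj (H (x * v)))"

text \<open>Expand the square over pairs \<open>x\<close>, \<open>z\<close>, substitute
  \<open>z = x * v\<close> and rescale \<open>y\<close> by \<open>x\<close>; homogeneity turns the
  sum over \<open>y\<close> into \<open>corr k v\<close>, independent of \<open>x\<close>.\<close>

lemma sum_kernel_units_le:
  assumes H: "periodic H"
  shows "(\<Sum>y\<in>residues. (cmod (\<Sum>x\<in>units. H x * ker k x y))^2)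
    \<le> (\<Sum>v\<in>units. cmod (corr k v) * cmod (mult_corr H v))"
proof -
  have inner: "(\<Sum>z\<in>units. cnj (H z) * (\<Sum>y\<in>residues. ker k x y * cnj (ker k z y)))
      = (\<Sum>v\<in>units. cnj (H (x * v)) * corr k v)" if x: "x \<in> units" for x
  proof -
    have nx: "\<not> p dvd x" using x by (rule units_not_dvd)
    have "(\<Sum>z\<in>units. cnj (H z) * (\<Sum>y\<in>residues. ker k x y * cnj (ker k z y)))
       = (\<Sum>v\<in>units. cnj (H (x * v)) * (\<Sum>y\<in>residues. ker k x y * cnj (ker k (x * v) y)))"
    proof (rule sum_units_scale[symmetric, OF periodicI nx])
      fix z z' assume zz': "[z = z'] (mod p)"
      have "ker k z y = ker k z' y" for y using zz' cong_refl by (rule ker_cong)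
      then show "cnj (H z) * (\<Sum>y\<in>residues. ker k x y * cnj (ker k z y))
          = cnj (H z') * (\<Sum>y\<in>residues. ker k x y * cnj (ker k z' y))"
        using periodicD[OF H zz'] by simp
    qed
    moreover have "(\<Sum>y\<in>residues. ker k x y * cnj (ker k (x * v) y)) = corr k v" for v
    proof -
      have "(\<Sum>y\<in>residues. ker k x y * cnj (ker k (x * v) y))
         = (\<Sum>y\<in>residues. ker k x (x * y + 0) * cnj (ker k (x * v) (x * y + 0)))"
      proof (rule sum_affine[symmetric, OF periodicI nx])
        fix y y' assume yy': "[y = y'] (mod p)"
        have "ker k z y = ker k z y'" for z using cong_refl yy' by (rule ker_cong)
        then show "ker k x y * cnj (ker k (x * v) y) = ker k x y' * cnj (ker k (x * v) y')" by simp
      qed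
      also have "\<dots> = (\<Sum>y\<in>residues. ker k (x * 1) (x * y) * cnj (ker k (x * v) (x * y)))" by simp
      finally show ?thesis unfolding corr_def ker_scale[OF nx] .
    qed
    ultimately show ?thesis by simp
  qed
  have "complex_of_real (\<Sum>y\<in>residues. (cmod (\<Sum>x\<in>units. H x * ker k x y))^2)
      = (\<Sum>y\<in>residues. \<Sum>x\<in>units. \<Sum>z\<in>units. H x * (cnj (H z) * (ker k x y * cnj (ker k z y))))"
    unfolding of_real_sum complex_norm_square cnj_sum sum_product by (simp add: mult_ac)
  also have "\<dots> = (\<Sum>x\<in>units. H x * (\<Sum>z\<in>units. cnj (H z) * (\<Sum>y\<in>residues. ker k x y * cnj (ker k z y))))"
    by (simp only: sum.swap[of _ _ residues] sum_distrib_left)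
  also have "\<dots> = (\<Sum>x\<in>units. \<Sum>v\<in>units. corr k v * (H x * cnj (H (x * v))))"
  proof (intro sum.cong refl)
    fix x assume "x \<in> units"
    then show "H x * (\<Sum>z\<in>units. cnj (H z) * (\<Sum>y\<in>residues. ker k x y * cnj (ker k z y)))
        = (\<Sum>v\<in>units. corr k v * (H x * cnj (H (x * v))))"
      by (simp only: inner) (simp add: sum_distrib_left mult_ac)
  qed
  also have "\<dots> = (\<Sum>v\<in>units. corr k v * mult_corr H v)"
    unfolding mult_corr_def sum_distrib_left by (rule sum.swap)
  finally have "(\<Sum>y\<in>residues. (cmod (\<Sum>x\<in>units. H x * ker k x y))^2)
      \<le> cmod (\<Sum>v\<in>units. corr k v * mult_corr H v)"
    by (rule le_cmod_of_real_eq)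
  also have "\<dots> \<le> (\<Sum>v\<in>units. cmod (corr k v) * cmod (mult_corr H v))"
    by (rule order_trans[OF norm_sum]) (simp add: norm_mult)
  finally show ?thesis .
qed

text \<open>Young's inequality for a convolution of an \<open>l1\<close> and an \<open>l2\<close>
  function: Cauchy-Schwarz with weight \<open>cmod (H x)\<close>, then summation over
  \<open>v\<close>, where scaling by the unit \<open>x\<close> leaves the sum of squares
  unchanged.\<close>

lemma sum_mult_corr_le:
  assumes H: "periodic H"
  shows "(\<Sum>v\<in>units. (cmod (mult_corr H v))^2) \<le> (\<Sum>x\<in>units. cmod (H x))^2 * (\<Sum>x\<in>units. (cmod (H x))^2)"
proof -
  have le: "(cmod (mult_corr H v))^2 \<le> (\<Sum>x\<in>units. cmod (H x)) * (\<Sum>x\<in>units. cmod (H x) * (cmod (H (x * v)))^2)" for v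
  proof -
    have "cmod (mult_corr H v) \<le> (\<Sum>x\<in>units. sqrt (cmod (H x)) * (sqrt (cmod (H x)) * cmod (H (x * v))))"
      unfolding mult_corr_def by (rule order_trans[OF norm_sum]) (simp add: norm_mult mult.assoc[symmetric])
    then have "(cmod (mult_corr H v))^2 \<le> (\<Sum>x\<in>units. sqrt (cmod (H x)) * (sqrt (cmod (H x)) * cmod (H (x * v))))^2"
      by (intro power_mono) auto
    also have "\<dots> \<le> (\<Sum>x\<in>units. (sqrt (cmod (H x)))^2) * (\<Sum>x\<in>units. (sqrt (cmod (H x)) * cmod (H (x * v)))^2)"
      by (rule Cauchy_Schwarz_ineq_sum)
    finally show ?thesis by (simp add: power_mult_distrib)
  qed
  have "(\<Sum>v\<in>units. (cmod (mult_corr H v))^2)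
      \<le> (\<Sum>v\<in>units. (\<Sum>x\<in>units. cmod (H x)) * (\<Sum>x\<in>units. cmod (H x) * (cmod (H (x * v)))^2))"
    by (intro sum_mono le)
  also have "\<dots> = (\<Sum>x\<in>units. cmod (H x)) * (\<Sum>v\<in>units. \<Sum>x\<in>units. cmod (H x) * (cmod (H (x * v)))^2)"
    by (simp only: sum_distrib_left)
  also have "(\<Sum>v\<in>units. \<Sum>x\<in>units. cmod (H x) * (cmod (H (x * v)))^2)
      = (\<Sum>x\<in>units. cmod (H x) * (\<Sum>v\<in>units. (cmod (H (x * v)))^2))"
    by (subst sum.swap) (simp only: sum_distrib_left)
  also have "\<dots> = (\<Sum>x\<in>units. cmod (H x) * (\<Sum>v\<in>units. (cmod (H v))^2))"
  proof (intro sum.cong refl)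
    fix x assume "x \<in> units"
    then have "(\<Sum>v\<in>units. (cmod (H (x * v)))^2) = (\<Sum>v\<in>units. (cmod (H v))^2)"
      using H by (intro sum_units_scale[of "\<lambda>v. (cmod (H v))^2"] units_not_dvd) (auto simp: periodic_def)
    then show "cmod (H x) * (\<Sum>v\<in>units. (cmod (H (x * v)))^2) = cmod (H x) * (\<Sum>v\<in>units. (cmod (H v))^2)"
      by simp
  qed
  finally show ?thesis by (simp add: power2_eq_square sum_distrib_right mult.assoc)
qed

text \<open>Cauchy-Schwarz in \<open>(k, v)\<close> separates the kernel autocorrelations, with
  total \<open>3 p^3\<close>, from those of \<open>H\<close>, with total \<open>M^4\<close>. The
  multiplicative argument covers only units \<open>x\<close>; the column \<open>x = 0\<close> is
  added by the trivial bound on \<open>ker\<close>.\<close>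

lemma sum_kernel_sq_le:
  assumes H: "\<And>k. periodic (H k)"
    and l1: "\<And>k. (\<Sum>x\<in>residues. cmod (H k x)) \<le> M"
    and l2: "(\<Sum>k\<in>units. \<Sum>x\<in>residues. (cmod (H k x))^2) \<le> M^2"
  shows "(\<Sum>k\<in>units. \<Sum>y\<in>residues. (cmod (\<Sum>x\<in>residues. H k x * ker k x y))^2) \<le> 6 * (of_int p * sqrt (of_int p)) * M^2"
proof -
  have M: "M \<ge> 0" using l1[of 0] by (rule order_trans[rotated]) (simp add: sum_nonneg)
  have pos: "real_of_int p > 0" "1 \<le> sqrt (real_of_int p)" using p_pos by auto
  have sub: "units \<subseteq> residues" by auto
  define S where "S k = (\<Sum>y\<in>residues. (cmod (\<Sum>x\<in>units. H k x * ker k x y))^2)" for k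
  have "(\<Sum>k\<in>units. S k)^2 \<le> 3 * of_int p^3 * M^4"
  proof -
    have "(\<Sum>k\<in>units. S k)^2 \<le> (\<Sum>k\<in>units. \<Sum>v\<in>units. cmod (corr k v) * cmod (mult_corr (H k) v))^2"
      unfolding S_def by (intro power_mono sum_mono sum_kernel_units_le H sum_nonneg) auto
    also have "\<dots> \<le> (\<Sum>k\<in>units. \<Sum>v\<in>units. (cmod (corr k v))^2) * (\<Sum>k\<in>units. \<Sum>v\<in>units. (cmod (mult_corr (H k) v))^2)"
      by (rule Cauchy_Schwarz_double_sum)
    also have "\<dots> \<le> (3 * of_int p^3) * (M^2 * M^2)"
    proof (rule mult_mono)
      show "(\<Sum>k\<in>units. \<Sum>v\<in>units. (cmod (corr k v))^2) \<le> 3 * of_int p^3"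
        using sub by (intro order_trans[OF sum_mono2 sum_sum_corr_le]) (auto intro: sum_nonneg)
      have "(\<Sum>k\<in>units. \<Sum>v\<in>units. (cmod (mult_corr (H k) v))^2)
          \<le> (\<Sum>k\<in>units. M^2 * (\<Sum>x\<in>residues. (cmod (H k x))^2))"
      proof (rule sum_mono)
        fix k
        have "(\<Sum>x\<in>units. cmod (H k x)) \<le> M"
          using sub by (intro order_trans[OF sum_mono2 l1]) auto
        then show "(\<Sum>v\<in>units. (cmod (mult_corr (H k) v))^2) \<le> M^2 * (\<Sum>x\<in>residues. (cmod (H k x))^2)"
          using sub by (intro order_trans[OF sum_mult_corr_le[OF H]] mult_mono power_mono sum_mono2)
            (auto intro: sum_nonneg)
      qed
      also have "\<dots> = M^2 * (\<Sum>k\<in>units. \<Sum>x\<in>residues. (cmod (H k x))^2)" by (simp only: sum_distrib_left)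
      also have "\<dots> \<le> M^2 * M^2" using l2 by (intro mult_left_mono) auto
      finally show "(\<Sum>k\<in>units. \<Sum>v\<in>units. (cmod (mult_corr (H k) v))^2) \<le> M^2 * M^2" .
    qed (use p_pos in \<open>auto intro!: sum_nonneg\<close>)
    finally show ?thesis by (simp add: power_add[symmetric] mult.assoc)
  qed
  \<comment> \<open>The factor 3 is enlarged to 4 to become a perfect square.\<close>
  also have "\<dots> \<le> (2 * (of_int p * sqrt (of_int p)) * M^2)^2"
  proof -
    have "(2 * (of_int p * sqrt (of_int p)) * M^2)^2 = 4 * (of_int p^2 * (sqrt (of_int p))^2) * (M^2)^2"
      by (simp add: power_mult_distrib)
    also have "\<dots> = 4 * of_int p^3 * M^4"
      using pos by (simp add: power3_eq_cube power2_eq_square power4_eq_xxxx)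
    finally show ?thesis using pos by (simp add: mult_right_mono)
  qed
  finally have S: "(\<Sum>k\<in>units. S k) \<le> 2 * (of_int p * sqrt (of_int p)) * M^2"
    using pos by (elim power2_le_imp_le) auto
  \<comment> \<open>The term \<open>x = 0\<close> is split off with
    \<open>(a + b)^2 \<le> 2 a^2 + 2 b^2\<close>; hence the final constant
    \<open>6 = 2 * 2 + 2\<close>.\<close>
  have "(\<Sum>y\<in>residues. (cmod (\<Sum>x\<in>residues. H k x * ker k x y))^2)
     \<le> 2 * S k + 2 * (of_int p * (\<Sum>x\<in>residues. (cmod (H k x))^2))" for k
  proof -
    have "(cmod (\<Sum>x\<in>residues. H k x * ker k x y))^2
       \<le> 2 * (cmod (\<Sum>x\<in>units. H k x * ker k x y))^2 + 2 * (cmod (H k 0))^2" for y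
    proof -
      have "cmod (\<Sum>x\<in>residues. H k x * ker k x y) \<le> cmod (H k 0 * ker k 0 y) + cmod (\<Sum>x\<in>units. H k x * ker k x y)"
        unfolding residues_insert by (simp add: norm_triangle_ineq)
      also have "cmod (H k 0 * ker k 0 y) \<le> cmod (H k 0)"
        by (simp add: norm_mult cmod_ker_le mult_left_le)
      finally have "(cmod (\<Sum>x\<in>residues. H k x * ker k x y))^2
          \<le> (cmod (H k 0) + cmod (\<Sum>x\<in>units. H k x * ker k x y))^2"
        by (intro power_mono) auto
      also have "\<dots> \<le> 2 * (cmod (\<Sum>x\<in>units. H k x * ker k x y))^2 + 2 * (cmod (H k 0))^2"
        using sum_squares_bound[of "cmod (H k 0)" "cmod (\<Sum>x\<in>units. H k x * ker k x y)"]
        by (simp add: power2_sum)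
      finally show ?thesis .
    qed
    then have "(\<Sum>y\<in>residues. (cmod (\<Sum>x\<in>residues. H k x * ker k x y))^2)
       \<le> (\<Sum>y\<in>residues. 2 * (cmod (\<Sum>x\<in>units. H k x * ker k x y))^2 + 2 * (cmod (H k 0))^2)"
      by (rule sum_mono)
    also have "\<dots> = 2 * S k + 2 * (of_int p * (cmod (H k 0))^2)"
      using p_pos by (simp add: sum.distrib sum_distrib_left S_def)
    also have "(cmod (H k 0))^2 \<le> (\<Sum>x\<in>residues. (cmod (H k x))^2)"
      using p_pos by (intro member_le_sum) auto
    finally show ?thesis using pos by simp
  qed
  then have "(\<Sum>k\<in>units. \<Sum>y\<in>residues. (cmod (\<Sum>x\<in>residues. H k x * ker k x y))^2)
     \<le> (\<Sum>k\<in>units. 2 * S k + 2 * (of_int p * (\<Sum>x\<in>residues. (cmod (H k x))^2)))"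
    by (rule sum_mono)
  also have "\<dots> = 2 * (\<Sum>k\<in>units. S k) + 2 * (of_int p * (\<Sum>k\<in>units. \<Sum>x\<in>residues. (cmod (H k x))^2))"
    by (simp add: sum.distrib sum_distrib_left)
  also have "\<dots> \<le> 2 * (2 * (of_int p * sqrt (of_int p)) * M^2) + 2 * (of_int p * sqrt (of_int p) * M^2)"
  proof (intro add_mono mult_left_mono S)
    have "of_int p * (\<Sum>k\<in>units. \<Sum>x\<in>residues. (cmod (H k x))^2) \<le> of_int p * (sqrt (of_int p) * M^2)"
      using l2 pos mult_right_mono[OF pos(2), of "M^2"] by (intro mult_left_mono) auto
    then show "of_int p * (\<Sum>k\<in>units. \<Sum>x\<in>residues. (cmod (H k x))^2) \<le> of_int p * sqrt (of_int p) * M^2"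
      by (simp add: mult.assoc)
  qed auto
  finally show ?thesis by simp
qed

text \<open>A further Cauchy-Schwarz, in \<open>(k, y)\<close>, removes the second factor
  \<open>H k y\<close> at the cost of another \<open>M^2\<close>.\<close>

lemma sum_bilinear_kernel_le:
  assumes H: "\<And>k. periodic (H k)"
    and l1: "\<And>k. (\<Sum>x\<in>residues. cmod (H k x)) \<le> M"
    and l2: "(\<Sum>k\<in>units. \<Sum>x\<in>residues. (cmod (H k x))^2) \<le> M^2"
  shows "(\<Sum>k\<in>units. cmod (\<Sum>x\<in>residues. \<Sum>y\<in>residues. H k x * cnj (H k y) * ker k x y))^2
    \<le> 6 * (of_int p * sqrt (of_int p)) * M^4"
proof -
  define I where "I k y = (\<Sum>x\<in>residues. H k x * ker k x y)" for k y
  have "cmod (\<Sum>x\<in>residues. \<Sum>y\<in>residues. H k x * cnj (H k y) * ker k x y)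
      \<le> (\<Sum>y\<in>residues. cmod (H k y) * cmod (I k y))" for k
  proof -
    have "(\<Sum>x\<in>residues. \<Sum>y\<in>residues. H k x * cnj (H k y) * ker k x y) = (\<Sum>y\<in>residues. cnj (H k y) * I k y)"
      unfolding I_def sum_distrib_left by (subst sum.swap) (simp add: mult_ac)
    then show ?thesis using norm_sum[of "\<lambda>y. cnj (H k y) * I k y" residues] by (simp add: norm_mult)
  qed
  then have "(\<Sum>k\<in>units. cmod (\<Sum>x\<in>residues. \<Sum>y\<in>residues. H k x * cnj (H k y) * ker k x y))^2
     \<le> (\<Sum>k\<in>units. \<Sum>y\<in>residues. cmod (H k y) * cmod (I k y))^2"
    by (intro power_mono sum_mono sum_nonneg) auto
  also have "\<dots> \<le> (\<Sum>k\<in>units. \<Sum>y\<in>residues. (cmod (H k y))^2) * (\<Sum>k\<in>units. \<Sum>y\<in>residues. (cmod (I k y))^2)"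
    by (rule Cauchy_Schwarz_double_sum)
  also have "\<dots> \<le> M^2 * (6 * (of_int p * sqrt (of_int p)) * M^2)"
    unfolding I_def using l2
    by (intro mult_mono sum_kernel_sq_le H l1) (auto intro!: sum_nonneg)
  finally show ?thesis by (simp add: power_add[symmetric] mult_ac)
qed

section \<open>Reduction to the kernel\<close>

definition dcoef :: "int \<Rightarrow> int \<Rightarrow> int" where
  "dcoef k x = - k * modular_inverse p (2 * (x^2 - k^2))"

lemma dcoef:
  assumes "\<not> p dvd x^2 - k^2"
  shows "[2 * (x^2 - k^2) * dcoef k x = - k] (mod p)"
proof -
  have "coprime (2 * (x^2 - k^2)) p"
    unfolding coprime_p_iff dvd_mult_iff using not_dvd_2 assms by simp
  then have "[- k * (2 * (x^2 - k^2) * modular_inverse p (2 * (x^2 - k^2))) = - k * 1] (mod p)"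
    by (intro cong_scalar_left cong_modular_inverse1)
  then show ?thesis by (simp add: dcoef_def mult_ac)
qed

lemma dcoef_cong: "[x = y] (mod p) \<Longrightarrow> [dcoef k x = dcoef k y] (mod p)"
  unfolding dcoef_def
  using inverse_cong[of "2 * (x^2 - k^2)" "2 * (y^2 - k^2)"]
  by (simp add: cong_scalar_left cong_diff cong_pow)

text \<open>Multiply the defining relation of each coefficient by the other coefficient and
  subtract; the terms with \<open>k^2\<close> cancel. This decides when the quadratic term vanishes
  and gives its Legendre symbol.\<close>

lemma dcoef_diff:
  assumes "\<not> p dvd x^2 - k^2" "\<not> p dvd y^2 - k^2"
  shows "[k * (dcoef k x - dcoef k y) = 2 * dcoef k x * dcoef k y * (x^2 - y^2)] (mod p)"
proof -
  let ?a = "dcoef k x" and ?b = "dcoef k y"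
  have "[?b * (2 * (x^2 - k^2) * ?a) - ?a * (2 * (y^2 - k^2) * ?b) = ?b * (- k) - ?a * (- k)] (mod p)"
    using assms by (intro cong_diff cong_scalar_left dcoef)
  then have "[?b * (- k) - ?a * (- k) = ?b * (2 * (x^2 - k^2) * ?a) - ?a * (2 * (y^2 - k^2) * ?b)] (mod p)"
    by (rule cong_sym)
  then show ?thesis by (simp add: algebra_simps)
qed

lemma dcoef_not_dvd:
  assumes "\<not> p dvd x^2 - k^2" "\<not> p dvd k"
  shows "\<not> p dvd dcoef k x"
  using cong_dvd_iff[OF dcoef[OF assms(1)]] assms by auto

text \<open>For \<open>y = - x\<close> the quadratic terms cancel and the sum vanishes, as does \<open>ker\<close>.\<close>

lemma quadratic_difference_sum:
  assumes k: "\<not> p dvd k" and x: "x \<in> residues" "\<not> p dvd x^2 - k^2" and y: "y \<in> residues" "\<not> p dvd y^2 - k^2"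
  shows "(\<Sum>r\<in>residues. e (dcoef k x * (r + x)^2 - dcoef k y * (r + y)^2))
     = (if x = y then of_int p else 0) + gauss 1 * chi (2 * k) * chi (dcoef k x) * chi (dcoef k y) * ker k x y"
proof -
  let ?a = "dcoef k x" and ?b = "dcoef k y"
  note na = dcoef_not_dvd[OF x(2) k] and nb = dcoef_not_dvd[OF y(2) k]
  note diff = dcoef_diff[OF x(2) y(2)]
  show ?thesis
  proof (cases "p dvd x^2 - y^2")
    case True
    have "p dvd k * (?a - ?b)" using cong_dvd_iff[OF diff] True by simp
    then have ab: "[?a = ?b] (mod p)" using k by (simp add: dvd_mult_iff cong_iff_dvd_diff)
    show ?thesis
    proof (cases "x = y")
      case True
      then show ?thesis using p_pos by (simp add: ker_eq_0)
    next
      case False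
      then have nxy: "\<not> p dvd x - y" using x(1) y(1) residues_eq_iff cong_iff_dvd_diff by blast
      have "e (?a * (r + x)^2 - ?b * (r + y)^2) = e (?a * (x^2 - y^2)) * e ((2 * ?a * (x - y)) * r)" for r
      proof -
        have "[?a * (r + x)^2 - ?b * (r + y)^2 = ?a * (r + x)^2 - ?a * (r + y)^2] (mod p)"
          by (intro cong_diff cong_scalar_right cong_refl cong_sym[OF ab])
        then have "e (?a * (r + x)^2 - ?b * (r + y)^2) = e (?a * (r + x)^2 - ?a * (r + y)^2)" by (rule e_cong)
        also have "?a * (r + x)^2 - ?a * (r + y)^2 = ?a * (x^2 - y^2) + (2 * ?a * (x - y)) * r"
          by (simp add: power2_eq_square algebra_simps)
        finally show ?thesis by (simp only: e_add)
      qed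
      moreover have "\<not> p dvd 2 * ?a * (x - y)" using na nxy not_dvd_2 by (simp add: dvd_mult_iff)
      ultimately show ?thesis using False True
        by (simp add: sum_distrib_left[symmetric] sum_e_linear ker_eq_0)
    qed
  next
    case False
    let ?A = "?a - ?b"
    have nxy: "\<not> p dvd x + y" "x \<noteq> y" using False dvd_diff_squares_iff by auto
    have nA: "\<not> p dvd ?A"
      using cong_dvd_iff[OF diff] False na nb not_dvd_2 by (auto simp: dvd_mult_iff)
    \<comment> \<open>Both sides equal \<open>- 4 ab (x - y)^2\<close>, where \<open>a\<close> and
      \<open>b\<close> are the two coefficients, so \<open>k * ratio x y\<close> is the constant
      left by completing the square.\<close>
    have "[4 * ?A * (k * ratio x y) = 4 * ?A * (?a * x^2 - ?b * y^2) - (2 * (?a * x - ?b * y))^2] (mod p)"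
    proof -
      have "[4 * ratio x y * (k * ?A) = 4 * ratio x y * (2 * ?a * ?b * (x^2 - y^2))] (mod p)"
        using diff by (rule cong_scalar_left)
      also have "4 * ratio x y * (2 * ?a * ?b * (x^2 - y^2)) = 4 * ?a * ?b * (x - y) * (2 * (x + y) * ratio x y)"
        by (simp add: power2_eq_square algebra_simps)
      also have "[4 * ?a * ?b * (x - y) * (2 * (x + y) * ratio x y) = 4 * ?a * ?b * (x - y) * (y - x)] (mod p)"
        using ratio[OF nxy(1)] by (rule cong_scalar_left)
      finally have "[4 * ratio x y * (k * ?A) = 4 * ?a * ?b * (x - y) * (y - x)] (mod p)" .
      then show ?thesis by (simp add: power2_eq_square algebra_simps)
    qed
    then have "(\<Sum>r\<in>residues. e (?A * r^2 + 2 * (?a * x - ?b * y) * r + (?a * x^2 - ?b * y^2))) = gauss ?A * e (k * ratio x y)"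
      by (rule gauss_quadratic[OF nA])
    moreover have "?A * r^2 + 2 * (?a * x - ?b * y) * r + (?a * x^2 - ?b * y^2) = ?a * (r + x)^2 - ?b * (r + y)^2" for r
      by (simp add: power2_eq_square algebra_simps)
    ultimately have "(\<Sum>r\<in>residues. e (?a * (r + x)^2 - ?b * (r + y)^2)) = gauss ?A * e (k * ratio x y)"
      by simp
    moreover have "Leg ?A = Leg (2 * k) * Leg ?a * Leg ?b * Leg (x^2 - y^2)"
    proof -
      \<comment> \<open>The Legendre symbol of \<open>dcoef_diff\<close>; multiplying once more by
        \<open>Leg k\<close>, whose square is 1, isolates \<open>Leg ?A\<close>.\<close>
      have "Leg k * Leg ?A = Leg (2 * ?a * ?b * (x^2 - y^2))"
        using Leg_cong[OF diff] by (simp only: Leg_mult)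
      then have "Leg k * (Leg k * Leg ?A) = Leg (2 * k) * Leg ?a * Leg ?b * Leg (x^2 - y^2)"
        by (simp add: Leg_mult)
      moreover have "Leg k * Leg k = 1" using abs_Leg[OF k] by (auto simp: abs_if split: if_splits)
      ultimately show ?thesis by (simp flip: mult.assoc)
    qed
    ultimately show ?thesis using nxy(2) gauss_Leg[OF nA] by (simp add: ker_def)
  qed
qed

lemma cmod_gauss_1: "cmod (gauss 1) = sqrt (of_int p)"
  using cmod_gauss[of 1] p_gt_2 by (metis abs_norm_cancel real_sqrt_abs not_prime_unit prime_p)

text \<open>In the expanded square the sum over \<open>r\<close> is the matrix of
  \<open>quadratic_difference_sum\<close>: its diagonal gives the first term, and the Gauss factor
  has modulus \<open>sqrt p\<close>. The real factors \<open>chi (dcoef k x)\<close> are absorbed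
  into \<open>G\<close>, which by assumption vanishes where the coefficient has no meaning.\<close>

lemma sum_phase_sq_le:
  assumes k: "\<not> p dvd k" and G0: "\<And>x. p dvd x^2 - k^2 \<Longrightarrow> G x = 0"
  shows "(\<Sum>r\<in>residues. (cmod (\<Sum>x\<in>residues. G x * e (dcoef k x * (r + x)^2)))^2)
    \<le> of_int p * (\<Sum>x\<in>residues. (cmod (G x))^2)
      + sqrt (of_int p) * cmod (\<Sum>x\<in>residues. \<Sum>y\<in>residues.
          (G x * chi (dcoef k x)) * cnj (G y * chi (dcoef k y)) * ker k x y)"
proof -
  let ?B = "\<Sum>x\<in>residues. \<Sum>y\<in>residues. (G x * chi (dcoef k x)) * cnj (G y * chi (dcoef k y)) * ker k x y"
  let ?d = "\<Sum>x\<in>residues. (cmod (G x))^2"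
  have entry: "G x * cnj (G y) * (\<Sum>r\<in>residues. e (dcoef k x * (r + x)^2 - dcoef k y * (r + y)^2))
     = (if x = y then G x * cnj (G y) * of_int p else 0)
       + gauss 1 * chi (2 * k) * ((G x * chi (dcoef k x)) * cnj (G y * chi (dcoef k y)) * ker k x y)"
    if "x \<in> residues" "y \<in> residues" for x y
  proof (cases "p dvd x^2 - k^2 \<or> p dvd y^2 - k^2")
    case True
    then show ?thesis using G0 by auto
  next
    case False
    then show ?thesis using that k by (subst quadratic_difference_sum) (auto simp: algebra_simps)
  qed
  have "complex_of_real (\<Sum>r\<in>residues. (cmod (\<Sum>x\<in>residues. G x * e (dcoef k x * (r + x)^2)))^2)
     = (\<Sum>r\<in>residues. \<Sum>x\<in>residues. \<Sum>y\<in>residues. G x * cnj (G y) * e (dcoef k x * (r + x)^2 - dcoef k y * (r + y)^2))"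
    unfolding of_real_sum complex_norm_square cnj_sum sum_product by (simp add: e_diff mult_ac)
  also have "\<dots> = (\<Sum>x\<in>residues. \<Sum>y\<in>residues. G x * cnj (G y) *
      (\<Sum>r\<in>residues. e (dcoef k x * (r + x)^2 - dcoef k y * (r + y)^2)))"
    unfolding sum_distrib_left by (subst sum.swap, rule sum.cong[OF refl], rule sum.swap)
  also have "\<dots> = (\<Sum>x\<in>residues. \<Sum>y\<in>residues. (if x = y then G x * cnj (G y) * of_int p else 0)
      + gauss 1 * chi (2 * k) * ((G x * chi (dcoef k x)) * cnj (G y * chi (dcoef k y)) * ker k x y))"
    by (intro sum.cong refl entry)
  also have "\<dots> = (\<Sum>x\<in>residues. \<Sum>y\<in>residues. if x = y then G x * cnj (G y) * of_int p else 0)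
      + gauss 1 * chi (2 * k) * ?B"
    by (simp only: sum.distrib sum_distrib_left)
  also have "(\<Sum>x\<in>residues. \<Sum>y\<in>residues. if x = y then G x * cnj (G y) * of_int p else 0)
     = complex_of_real (of_int p * ?d)"
    by (simp add: sum.delta complex_norm_square sum_distrib_left mult_ac del: of_real_power)
  finally have "(\<Sum>r\<in>residues. (cmod (\<Sum>x\<in>residues. G x * e (dcoef k x * (r + x)^2)))^2)
     \<le> cmod (complex_of_real (of_int p * ?d) + gauss 1 * chi (2 * k) * ?B)"
    by (rule le_cmod_of_real_eq)
  also have "\<dots> \<le> cmod (complex_of_real (of_int p * ?d)) + cmod (gauss 1 * chi (2 * k) * ?B)"
    by (rule norm_triangle_ineq)
  also have "cmod (complex_of_real (of_int p * ?d)) = of_int p * ?d"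
    unfolding norm_of_real using p_pos by (intro abs_of_nonneg mult_nonneg_nonneg sum_nonneg) auto
  also have "cmod (gauss 1 * chi (2 * k) * ?B) \<le> (sqrt (of_int p) * 1) * cmod ?B"
    unfolding norm_mult cmod_gauss_1 by (intro mult_mono cmod_chi_le) (use p_pos in auto)
  finally show ?thesis by simp
qed

text \<open>The substitution \<open>m = x - k\<close>, \<open>n = x + k\<close> is bijective because
  2 is invertible: first \<open>n = 2 k + m\<close>, then \<open>m = x - k\<close>.\<close>

lemma sum_sum_rotate:
  fixes \<Phi> :: "int \<Rightarrow> int \<Rightarrow> 'b::comm_monoid_add"
  assumes "\<And>m m' n n'. [m = m'] (mod p) \<Longrightarrow> [n = n'] (mod p) \<Longrightarrow> \<Phi> m n = \<Phi> m' n'"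
  shows "(\<Sum>m\<in>residues. \<Sum>n\<in>residues. \<Phi> m n) = (\<Sum>k\<in>residues. \<Sum>x\<in>residues. \<Phi> (x - k) (x + k))"
proof -
  have "(\<Sum>m\<in>residues. \<Sum>n\<in>residues. \<Phi> m n) = (\<Sum>m\<in>residues. \<Sum>k\<in>residues. \<Phi> m (2 * k + m))"
    by (intro sum.cong refl sum_affine[symmetric] periodicI assms not_dvd_2) auto
  also have "\<dots> = (\<Sum>k\<in>residues. \<Sum>m\<in>residues. \<Phi> m (2 * k + m))" by (rule sum.swap)
  also have "\<dots> = (\<Sum>k\<in>residues. \<Sum>x\<in>residues. \<Phi> (x + - k) (2 * k + (x + - k)))"
    by (intro sum.cong refl sum_shift[symmetric] periodicI assms) (auto intro: cong_rules)
  finally show ?thesis by (simp add: algebra_simps)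
qed

text \<open>The residue \<open>- 1 / (4 m)\<close>, the coefficient of \<open>s^2\<close> in the
  phase \<open>- (s - m)^2 / (4 m)\<close> left by the Gauss sum.\<close>

definition mu :: "int \<Rightarrow> int" where
  "mu m = - modular_inverse p (4 * m)"

lemma mu:
  assumes "\<not> p dvd m" shows "[4 * m * mu m = - 1] (mod p)"
proof -
  have four: "4 * m = 2 * (2 * m)" by simp
  have "coprime (4 * m) p"
    unfolding four coprime_p_iff dvd_mult_iff using assms not_dvd_2 by blast
  then have "[- (4 * m * modular_inverse p (4 * m)) = - 1] (mod p)"
    by (intro cong_uminus cong_modular_inverse1)
  then show ?thesis by (simp add: mu_def)
qed

lemma mu_cong: "[m = n] (mod p) \<Longrightarrow> mu m = mu n"
  unfolding mu_def using inverse_cong[of "4 * m" "4 * n"] by (simp add: cong_scalar_left)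

text \<open>Here \<open>- 1 / (4 (x - k)) + 1 / (4 (x + k)) = - 2 k / (4 (x^2 -
  k^2))\<close>.\<close>

lemma mu_diff:
  assumes k: "\<not> p dvd x - k" "\<not> p dvd x + k"
  shows "[mu (x - k) - mu (x + k) = dcoef k x] (mod p)"
proof -
  have sq: "x^2 - k^2 = (x - k) * (x + k)" by (simp add: power2_eq_square algebra_simps)
  have nd: "\<not> p dvd x^2 - k^2" using k unfolding sq by (simp add: dvd_mult_iff)
  have "[(x + k) * (4 * (x - k) * mu (x - k)) - (x - k) * (4 * (x + k) * mu (x + k))
      = (x + k) * (- 1) - (x - k) * (- 1)] (mod p)"
    using k by (intro cong_diff cong_scalar_left mu)
  then have "[2 * (2 * (x^2 - k^2)) * (mu (x - k) - mu (x + k)) = 2 * (- k)] (mod p)"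
    by (simp add: power2_eq_square algebra_simps)
  also have "[2 * (- k) = 2 * (2 * (x^2 - k^2) * dcoef k x)] (mod p)"
    by (intro cong_scalar_left cong_sym[OF dcoef] nd)
  finally have "[2 * (2 * (x^2 - k^2)) * (mu (x - k) - mu (x + k)) = 2 * (2 * (x^2 - k^2)) * dcoef k x] (mod p)"
    by (simp only: mult.assoc)
  moreover have "\<not> p dvd 2 * (2 * (x^2 - k^2))" unfolding dvd_mult_iff using nd not_dvd_2 by blast
  ultimately show ?thesis using cong_cancel by blast
qed

section \<open>The twisted convolution \<open>W\<close> and its second moment\<close>

definition twisted_conv :: "(int \<Rightarrow> complex) \<Rightarrow> (int \<Rightarrow> complex) \<Rightarrow> int \<Rightarrow> complex" where
  "twisted_conv g f s = (\<Sum>m\<in>residues. g m * f (s - m) * e (s^2 * mu m))"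

definition phase_sum :: "(int \<Rightarrow> complex) \<Rightarrow> int \<Rightarrow> int \<Rightarrow> complex" where
  "phase_sum g k r = (\<Sum>x\<in>residues. g (x - k) * cnj (g (x + k)) * e ((r + x)^2 * (mu (x - k) - mu (x + k))))"

text \<open>With \<open>m = x - k\<close>, \<open>n = x + k\<close> and \<open>s = r + x\<close> the
  arguments of \<open>f\<close> become \<open>r + k\<close> and \<open>r - k\<close>. They are free
  of \<open>x\<close>, so \<open>f\<close> leaves the inner sum.\<close>

lemma sum_twisted_conv_sq:
  assumes g: "periodic g" and f: "periodic f"
  shows "complex_of_real (\<Sum>s\<in>residues. (cmod (twisted_conv g f s))^2)
    = (\<Sum>k\<in>residues. \<Sum>r\<in>residues. f (r + k) * cnj (f (r - k)) * phase_sum g k r)"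
proof -
  define \<Psi> where "\<Psi> s m n = g m * cnj (g n) * (f (s - m) * cnj (f (s - n))) * e (s^2 * (mu m - mu n))" for s m n
  have \<Psi>_cong: "\<Psi> s m n = \<Psi> s' m' n'"
    if "[s = s'] (mod p)" "[m = m'] (mod p)" "[n = n'] (mod p)" for s s' m m' n n'
  proof -
    have "g m = g m'" "g n = g n'" using g that periodicD by blast+
    moreover have "f (s - m) = f (s' - m')" "f (s - n) = f (s' - n')" using f that periodicD cong_diff by blast+
    moreover have "e (s^2 * (mu m - mu n)) = e (s'^2 * (mu m' - mu n'))"
      unfolding mu_cong[OF that(2)] mu_cong[OF that(3)] using that by (intro e_cong cong_rules)
    ultimately show ?thesis by (simp add: \<Psi>_def)
  qed
  have "complex_of_real (\<Sum>s\<in>residues. (cmod (twisted_conv g f s))^2)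
      = (\<Sum>s\<in>residues. \<Sum>m\<in>residues. \<Sum>n\<in>residues. \<Psi> s m n)"
    unfolding of_real_sum complex_norm_square twisted_conv_def cnj_sum sum_product \<Psi>_def right_diff_distrib e_diff
    by (simp add: mult_ac)
  also have "\<dots> = (\<Sum>s\<in>residues. \<Sum>k\<in>residues. \<Sum>x\<in>residues. \<Psi> s (x - k) (x + k))"
    by (intro sum.cong refl sum_sum_rotate \<Psi>_cong) auto
  also have "\<dots> = (\<Sum>k\<in>residues. \<Sum>x\<in>residues. \<Sum>s\<in>residues. \<Psi> s (x - k) (x + k))"
    by (subst sum.swap, rule sum.cong[OF refl], rule sum.swap)
  also have "\<dots> = (\<Sum>k\<in>residues. \<Sum>x\<in>residues. \<Sum>r\<in>residues. \<Psi> (r + x) (x - k) (x + k))"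
    by (intro sum.cong refl sum_shift[symmetric] periodicI \<Psi>_cong) auto
  also have "\<dots> = (\<Sum>k\<in>residues. \<Sum>r\<in>residues. \<Sum>x\<in>residues. \<Psi> (r + x) (x - k) (x + k))"
    by (rule sum.cong[OF refl], rule sum.swap)
  also have "\<dots> = (\<Sum>k\<in>residues. \<Sum>r\<in>residues. f (r + k) * cnj (f (r - k)) * phase_sum g k r)"
    unfolding \<Psi>_def phase_sum_def sum_distrib_left by (intro sum.cong refl) (simp add: algebra_simps)
  finally show ?thesis .
qed

lemma sum_sum_product_sq:
  assumes f: "periodic f"
  shows "(\<Sum>k\<in>residues. \<Sum>x\<in>residues. (cmod (f (x - k) * cnj (f (x + k))))^2) = (\<Sum>x\<in>residues. (cmod (f x))^2)^2"
proof -
  have "(\<Sum>x\<in>residues. (cmod (f x))^2)^2 = (\<Sum>m\<in>residues. \<Sum>n\<in>residues. (cmod (f m * cnj (f n)))^2)"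
    by (simp add: power2_eq_square[of "sum _ _"] sum_product norm_mult power_mult_distrib)
  also have "\<dots> = (\<Sum>k\<in>residues. \<Sum>x\<in>residues. (cmod (f (x - k) * cnj (f (x + k))))^2)"
  proof (rule sum_sum_rotate)
    fix m m' n n' assume "[m = m'] (mod p)" "[n = n'] (mod p)"
    then have "f m = f m'" "f n = f n'" using f periodicD by blast+
    then show "(cmod (f m * cnj (f n)))^2 = (cmod (f m' * cnj (f n')))^2" by simp
  qed
  finally show ?thesis by simp
qed

text \<open>The arithmetic-geometric mean inequality and shift invariance; this supplies the
  \<open>l1\<close> bound by \<open>M\<close>, uniformly in \<open>k\<close>.\<close>

lemma sum_product_shift_le:
  assumes g: "periodic g"
  shows "(\<Sum>x\<in>residues. cmod (g (x - k) * cnj (g (x + k)))) \<le> (\<Sum>x\<in>residues. (cmod (g x))^2)"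
proof -
  have per: "periodic (\<lambda>x. (cmod (g x))^2)" using g by (auto simp: periodic_def)
  have "(\<Sum>x\<in>residues. cmod (g (x - k) * cnj (g (x + k))))
     \<le> (\<Sum>x\<in>residues. ((cmod (g (x + - k)))^2 + (cmod (g (x + k)))^2) / 2)"
  proof (rule sum_mono)
    fix x
    show "cmod (g (x - k) * cnj (g (x + k))) \<le> ((cmod (g (x + - k)))^2 + (cmod (g (x + k)))^2) / 2"
      using sum_squares_bound[of "cmod (g (x - k))" "cmod (g (x + k))"] by (simp add: norm_mult)
  qed
  also have "\<dots> = ((\<Sum>x\<in>residues. (cmod (g (x + - k)))^2) + (\<Sum>x\<in>residues. (cmod (g (x + k)))^2)) / 2"
    by (simp add: sum.distrib sum_divide_distrib add_divide_distrib)
  also have "\<dots> = (\<Sum>x\<in>residues. (cmod (g x))^2)"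
    using sum_shift[OF per, of "- k"] sum_shift[OF per, of k] by simp
  finally show ?thesis .
qed

text \<open>At \<open>x = k\<close> and \<open>x = - k\<close> modulo \<open>p\<close>, where
  \<open>mu_diff\<close> does not apply, a factor \<open>g\<close> vanishes.\<close>

lemma phase_sum_eq:
  assumes k: "\<not> p dvd k" and g0: "\<And>x. p dvd x \<Longrightarrow> g x = 0"
  shows "phase_sum g k r = (\<Sum>x\<in>residues. (g (x - k) * cnj (g (x + k))) * e (dcoef k x * (r + x)^2))"
  unfolding phase_sum_def
proof (intro sum.cong refl)
  fix x
  show "g (x - k) * cnj (g (x + k)) * e ((r + x)^2 * (mu (x - k) - mu (x + k)))
      = (g (x - k) * cnj (g (x + k))) * e (dcoef k x * (r + x)^2)"
  proof (cases "p dvd x - k \<or> p dvd x + k")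
    case True then show ?thesis using g0 by auto
  next
    case False
    then have "e ((r + x)^2 * (mu (x - k) - mu (x + k))) = e ((r + x)^2 * dcoef k x)"
      by (intro e_cong cong_scalar_left mu_diff) auto
    then show ?thesis by (simp add: mult.commute)
  qed
qed

text \<open>With \<open>w\<close> the fourth root of \<open>p\<close>, \<open>k = 0\<close> and the
  diagonal terms cost \<open>w^4 M^2\<close> each. The off-diagonal part costs
  \<open>sqrt p = w^2\<close> times the bilinear form, which is at most \<open>3 w^3 M^2\<close>,
  and so dominates with \<open>w^5\<close>.\<close>

lemma sum_phase_sum_sq_le:
  fixes g :: "int \<Rightarrow> complex"
  assumes g: "periodic g" and g0: "\<And>x. p dvd x \<Longrightarrow> g x = 0"
  defines "M \<equiv> \<Sum>x\<in>residues. (cmod (g x))^2" and "w \<equiv> sqrt (sqrt (of_int p))"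
  shows "(\<Sum>k\<in>residues. \<Sum>r\<in>residues. (cmod (phase_sum g k r))^2) \<le> 5 * w^5 * M^2"
proof -
  define G where "G k x = g (x - k) * cnj (g (x + k))" for k x
  define H where "H k x = G k x * chi (dcoef k x)" for k x
  define B where "B k = cmod (\<Sum>x\<in>residues. \<Sum>y\<in>residues. H k x * cnj (H k y) * ker k x y)" for k
  have M: "M \<ge> 0" unfolding M_def by (simp add: sum_nonneg)
  have w: "w \<ge> 1" "sqrt (of_int p) = w^2" "real_of_int p = w^4"
  proof -
    show "w \<ge> 1" using p_pos by (simp add: w_def)
    show w2: "sqrt (of_int p) = w^2" using p_pos by (simp add: w_def)
    have "w^4 = (w^2)^2" by (simp flip: power_mult)
    also have "\<dots> = of_int p" using p_pos by (simp flip: w2)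
    finally show "real_of_int p = w^4" by simp
  qed
  have perH: "periodic (H k)" for k
  proof (rule periodicI)
    fix x y assume xy: "[x = y] (mod p)"
    have "g (x - k) = g (y - k)" "g (x + k) = g (y + k)"
      using xy by (auto intro!: periodicD[OF g] cong_rules)
    moreover have "Leg (dcoef k x) = Leg (dcoef k y)" using xy by (intro Leg_cong dcoef_cong)
    ultimately show "H k x = H k y" by (simp add: H_def G_def)
  qed
  have H_le: "cmod (H k x) \<le> cmod (G k x)" for k x
    unfolding H_def norm_mult by (intro mult_left_le cmod_chi_le norm_ge_zero)
  have GM: "(\<Sum>k\<in>units. \<Sum>x\<in>residues. (cmod (G k x))^2) \<le> M^2"
  proof -
    have "(\<Sum>k\<in>units. \<Sum>x\<in>residues. (cmod (G k x))^2) \<le> (\<Sum>k\<in>residues. \<Sum>x\<in>residues. (cmod (G k x))^2)"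
      by (rule sum_mono2) (auto intro: sum_nonneg)
    then show ?thesis unfolding G_def sum_sum_product_sq[OF g] M_def .
  qed
  have "(\<Sum>k\<in>units. B k)^2 \<le> 6 * (of_int p * sqrt (of_int p)) * M^4"
    unfolding B_def
  proof (rule sum_bilinear_kernel_le[OF perH])
    fix k
    have "(\<Sum>x\<in>residues. cmod (H k x)) \<le> (\<Sum>x\<in>residues. cmod (G k x))" by (intro sum_mono H_le)
    also have "\<dots> \<le> M" unfolding G_def M_def by (rule sum_product_shift_le[OF g])
    finally show "(\<Sum>x\<in>residues. cmod (H k x)) \<le> M" .
  next
    show "(\<Sum>k\<in>units. \<Sum>x\<in>residues. (cmod (H k x))^2) \<le> M^2"
      by (rule order_trans[OF _ GM]) (intro sum_mono power_mono H_le norm_ge_zero)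
  qed
  also have "\<dots> \<le> (3 * w^3 * M^2)^2"
  proof -
    have "6 * (of_int p * sqrt (of_int p)) * M^4 = 6 * (w^3 * M^2)^2"
      unfolding w(2) unfolding w(3) by (simp add: power_mult_distrib flip: power_mult power_add)
    also have "\<dots> \<le> 9 * (w^3 * M^2)^2" by simp
    finally show ?thesis by (simp add: power_mult_distrib)
  qed
  finally have Bsum: "(\<Sum>k\<in>units. B k) \<le> 3 * w^3 * M^2"
    using w by (elim power2_le_imp_le) auto
  \<comment> \<open>For \<open>k = 0\<close> the phases cancel and there is no oscillation.\<close>
  have phase_0: "(\<Sum>r\<in>residues. (cmod (phase_sum g 0 r))^2) = of_int p * M^2"
  proof -
    have "phase_sum g 0 r = complex_of_real M" for r
      unfolding phase_sum_def M_def by (simp add: complex_norm_square del: of_real_power)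
    then show ?thesis using p_pos by simp
  qed
  have "(\<Sum>r\<in>residues. (cmod (phase_sum g k r))^2) \<le> of_int p * (\<Sum>x\<in>residues. (cmod (G k x))^2) + sqrt (of_int p) * B k"
    if "k \<in> units" for k
  proof -
    have k: "\<not> p dvd k" using that by (rule units_not_dvd)
    have "G k x = 0" if "p dvd x^2 - k^2" for x
      using that g0 unfolding dvd_diff_squares_iff G_def by auto
    then have "(\<Sum>r\<in>residues. (cmod (\<Sum>x\<in>residues. G k x * e (dcoef k x * (r + x)^2)))^2)
        \<le> of_int p * (\<Sum>x\<in>residues. (cmod (G k x))^2) + sqrt (of_int p) * B k"
      unfolding B_def H_def by (rule sum_phase_sq_le[OF k])
    moreover have "phase_sum g k r = (\<Sum>x\<in>residues. G k x * e (dcoef k x * (r + x)^2))" for r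
      unfolding G_def using k g0 by (rule phase_sum_eq)
    ultimately show ?thesis by simp
  qed
  then have "(\<Sum>k\<in>units. \<Sum>r\<in>residues. (cmod (phase_sum g k r))^2)
     \<le> (\<Sum>k\<in>units. of_int p * (\<Sum>x\<in>residues. (cmod (G k x))^2) + sqrt (of_int p) * B k)"
    by (rule sum_mono)
  also have "\<dots> = of_int p * (\<Sum>k\<in>units. \<Sum>x\<in>residues. (cmod (G k x))^2) + sqrt (of_int p) * (\<Sum>k\<in>units. B k)"
    by (simp only: sum.distrib sum_distrib_left)
  also have "\<dots> \<le> of_int p * M^2 + sqrt (of_int p) * (3 * w^3 * M^2)"
    using p_pos by (intro add_mono mult_left_mono GM Bsum) auto
  finally have "(\<Sum>k\<in>residues. \<Sum>r\<in>residues. (cmod (phase_sum g k r))^2) \<le> 2 * of_int p * M^2 + sqrt (of_int p) * (3 * w^3 * M^2)"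
    unfolding residues_insert[symmetric] using phase_0 by (subst residues_insert) simp
  also have "\<dots> = 2 * w^4 * M^2 + 3 * w^5 * M^2"
    unfolding w(2) unfolding w(3) by (simp add: power_numeral_reduce mult_ac)
  also have "\<dots> \<le> 2 * w^5 * M^2 + 3 * w^5 * M^2"
    using w(1) by (intro add_mono mult_right_mono mult_left_mono power_increasing) auto
  finally show ?thesis by (simp add: mult_ac)
qed

text \<open>Cauchy-Schwarz in \<open>(k, r)\<close> separates \<open>f\<close> from the phase
  sums.\<close>

lemma sum_twisted_conv_sq_le:
  fixes g f :: "int \<Rightarrow> complex"
  assumes g: "periodic g" and g0: "\<And>x. p dvd x \<Longrightarrow> g x = 0" and f: "periodic f"
  shows "(\<Sum>s\<in>residues. (cmod (twisted_conv g f s))^2)^2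
    \<le> 5 * (sqrt (sqrt (of_int p)))^5 * (\<Sum>x\<in>residues. (cmod (g x))^2)^2 * (\<Sum>x\<in>residues. (cmod (f x))^2)^2"
proof -
  have "(\<Sum>s\<in>residues. (cmod (twisted_conv g f s))^2)
      \<le> cmod (\<Sum>k\<in>residues. \<Sum>r\<in>residues. f (r + k) * cnj (f (r - k)) * phase_sum g k r)"
    by (rule le_cmod_of_real_eq[OF sum_twisted_conv_sq[OF g f]])
  also have "\<dots> \<le> (\<Sum>k\<in>residues. \<Sum>r\<in>residues. cmod (f (r - k) * cnj (f (r + k))) * cmod (phase_sum g k r))"
    by (intro order_trans[OF norm_sum] sum_mono) (simp add: norm_mult mult_ac)
  finally have "(\<Sum>s\<in>residues. (cmod (twisted_conv g f s))^2)^2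
      \<le> (\<Sum>k\<in>residues. \<Sum>r\<in>residues. cmod (f (r - k) * cnj (f (r + k))) * cmod (phase_sum g k r))^2"
    by (intro power_mono sum_nonneg) auto
  also have "\<dots> \<le> (\<Sum>k\<in>residues. \<Sum>r\<in>residues. (cmod (f (r - k) * cnj (f (r + k))))^2)
      * (\<Sum>k\<in>residues. \<Sum>r\<in>residues. (cmod (phase_sum g k r))^2)"
    by (rule Cauchy_Schwarz_double_sum)
  also have "\<dots> \<le> (\<Sum>x\<in>residues. (cmod (f x))^2)^2 * (5 * (sqrt (sqrt (of_int p)))^5 * (\<Sum>x\<in>residues. (cmod (g x))^2)^2)"
    unfolding sum_sum_product_sq[OF f] by (intro mult_left_mono sum_phase_sum_sq_le g g0) auto
  finally show ?thesis by (simp add: mult_ac)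
qed

section \<open>Reduction of the operator \<open>T\<close> to the twisted convolution\<close>

lemma gauss_cong: "[a = b] (mod p) \<Longrightarrow> gauss a = gauss b"
  unfolding gauss_def by (intro sum.cong refl e_cong cong_scalar_right)

lemma Kker_cong: "[a = a'] (mod p) \<Longrightarrow> [b = b'] (mod p) \<Longrightarrow> Kker p a b = Kker p a' b'"
  unfolding Kker_def by (intro arg_cong2[where f="(*)"] sum.cong refl e_cong cong_add cong_scalar_right)

lemma Kker_eq:
  assumes "\<not> p dvd a" "[4 * a * c = - (b^2)] (mod p)"
  shows "Kker p a b = gauss a * e c / of_int p"
  using gauss_quadratic[of a c 0 b] assms by (simp add: Kker_def)

text \<open>With \<open>A\<close>, \<open>N\<close> the squared norms of \<open>f1\<close>,
  \<open>f2\<close>, the fourth power of the norm of \<open>T\<close> is at most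
  \<open>5 p^(5/4) (p A)^2 N^2 / p^4 = 5 p^(-3/4) A^2 N^2\<close>; the fourth root gives the
  exponent \<open>- 3/16\<close>.\<close>

lemma l2cmod_Top_le: "l2norm p (Top p f1 f2) \<le> 2 * (real_of_int p) powr (-3/16) * l2norm p f1 * l2norm p f2"
proof -
  define f where "f x = f2 (x mod p)" for x
  \<comment> \<open>The phase \<open>- (s - m)^2 / (4 m)\<close> is
    \<open>s^2 * mu m - 2 * s * mu 1 + m * mu 1\<close>. Its last term depends on \<open>m\<close>
    alone and joins \<open>g\<close>; the middle one depends on \<open>s\<close> alone and drops out
    of the modulus.\<close>
  define g where "g m = (if p dvd m then 0 else f1 (m mod p) * gauss m * e (m * mu 1))" for m
  have f: "periodic f" by (simp add: periodic_def f_def Cong.cong_def)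
  have g: "periodic g"
  proof (rule periodicI)
    fix m n assume mn: "[m = n] (mod p)"
    have "e (m * mu 1) = e (n * mu 1)" using mn by (intro e_cong cong_scalar_right)
    moreover have "m mod p = n mod p" using mn by (simp only: Cong.cong_def)
    ultimately show "g m = g n"
      using gauss_cong[OF mn] cong_dvd_iff[OF mn] by (simp add: g_def)
  qed
  have cmod_Top: "cmod (Top p f1 f2 s) = cmod (twisted_conv g f s) / of_int p" if s: "s \<in> residues" for s
  proof -
    \<comment> \<open>Setting the summand to zero at \<open>n = s\<close> gives a periodic function
      on all residues, ready for the substitution \<open>n = s - m\<close>.\<close>
    define \<Psi> where "\<Psi> n = (if p dvd s - n then 0 else f1 ((s - n) mod p) * f2 (n mod p) * Kker p (s - n) n)" for n
    have per: "periodic \<Psi>"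
    proof (rule periodicI)
      fix m n assume mn: "[m = n] (mod p)"
      then have sub: "[s - m = s - n] (mod p)" by (intro cong_diff cong_refl)
      have "(s - m) mod p = (s - n) mod p" "m mod p = n mod p"
        using mn sub by (simp_all only: Cong.cong_def)
      then show "\<Psi> m = \<Psi> n" using Kker_cong[OF sub mn] cong_dvd_iff[OF sub] by (simp add: \<Psi>_def)
    qed
    have "Top p f1 f2 s = (\<Sum>n\<in>residues. \<Psi> n)"
      unfolding Top_def
    proof (intro sum.mono_neutral_cong_left)
      show "\<forall>n\<in>residues - (residues - {s mod p}). \<Psi> n = 0" using s by (auto simp: \<Psi>_def)
      fix n assume n: "n \<in> residues - {s mod p}"
      then have "\<not> [s = n] (mod p)" using s residues_eq_iff by auto
      then have "\<not> p dvd s - n" by (simp add: cong_iff_dvd_diff)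
      then show "f1 ((s - n) mod p) * f2 n * Kker p ((s - n) mod p) n = \<Psi> n"
        using n Kker_cong[of "(s - n) mod p" "s - n" n n] by (simp add: \<Psi>_def)
    qed auto
    also have "\<dots> = (\<Sum>m\<in>residues. \<Psi> (- 1 * m + s))"
      using p_gt_2 by (intro sum_affine[symmetric] per) auto
    also have "\<dots> = (\<Sum>m\<in>residues. (e (- 2 * s * mu 1) / of_int p) * (g m * f (s - m) * e (s^2 * mu m)))"
    proof (intro sum.cong refl)
      fix m
      show "\<Psi> (- 1 * m + s) = (e (- 2 * s * mu 1) / of_int p) * (g m * f (s - m) * e (s^2 * mu m))"
      proof (cases "p dvd m")
        case True then show ?thesis by (simp add: \<Psi>_def g_def)
      next
        case False
        have "[s^2 * (4 * m * mu m) + m * (m - 2 * s) * (4 * 1 * mu 1) = s^2 * (- 1) + m * (m - 2 * s) * (- 1)] (mod p)"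
          using False p_gt_2 by (intro cong_add cong_scalar_left mu) auto
        then have "[4 * m * (s^2 * mu m + - 2 * s * mu 1 + m * mu 1) = - ((s - m)^2)] (mod p)"
          by (simp add: power2_eq_square algebra_simps)
        then have "Kker p m (s - m) = gauss m * e (s^2 * mu m + - 2 * s * mu 1 + m * mu 1) / of_int p"
          using False by (intro Kker_eq)
        then show ?thesis using False by (simp add: \<Psi>_def g_def f_def e_add del: add_uminus_conv_diff mult_minus_left)
      qed
    qed
    also have "\<dots> = (e (- 2 * s * mu 1) / of_int p) * twisted_conv g f s"
      unfolding twisted_conv_def sum_distrib_left ..
    finally show ?thesis using p_pos by (simp add: norm_mult norm_divide)
  qed
  define A where "A = (\<Sum>x\<in>residues. (cmod (f1 x))^2)"
  define N where "N = (\<Sum>x\<in>residues. (cmod (f2 x))^2)"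
  define q where "q = real_of_int p"
  have q: "q > 0" using p_pos by (simp add: q_def)
  have gA: "(\<Sum>x\<in>residues. (cmod (g x))^2) \<le> q * A"
  proof -
    have "(cmod (g x))^2 \<le> q * (cmod (f1 x))^2" if "x \<in> residues" for x
      using that cmod_gauss[of x] q by (auto simp: g_def q_def norm_mult power_mult_distrib)
    then show ?thesis unfolding A_def sum_distrib_left by (rule sum_mono)
  qed
  have fN: "(\<Sum>x\<in>residues. (cmod (f x))^2) = N" unfolding N_def by (intro sum.cong) (auto simp: f_def)
  have "(\<Sum>s\<in>residues. (cmod (Top p f1 f2 s))^2) = (\<Sum>s\<in>residues. (cmod (twisted_conv g f s))^2) / q^2"
    by (simp add: cmod_Top power_divide sum_divide_distrib q_def)
  then have "(\<Sum>s\<in>residues. (cmod (Top p f1 f2 s))^2)^2 = (\<Sum>s\<in>residues. (cmod (twisted_conv g f s))^2)^2 / q^4"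
    by (simp add: power_divide flip: power_mult)
  also have "\<dots> \<le> (5 * (sqrt (sqrt q))^5 * (\<Sum>x\<in>residues. (cmod (g x))^2)^2 * N^2) / q^4"
    using sum_twisted_conv_sq_le[OF g _ f] q by (intro divide_right_mono) (auto simp: fN q_def g_def)
  also have "\<dots> \<le> (5 * (sqrt (sqrt q))^5 * (q * A)^2 * N^2) / q^4"
    using gA q by (intro divide_right_mono mult_right_mono mult_left_mono power_mono) (auto intro: sum_nonneg)
  also have "\<dots> = 5 * ((sqrt (sqrt q))^5 / q^2) * A^2 * N^2"
    using q by (simp add: field_simps power2_eq_square power4_eq_xxxx)
  also have "(sqrt (sqrt q))^5 / q^2 = (q powr (-3/16))^4"
  proof -
    have pow: "(q powr a)^n = q powr (a * real n)" for a n
      using q by (simp add: powr_powr flip: powr_realpow)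
    have "sqrt (sqrt q) = q powr (1/4)" using q by (simp add: powr_powr flip: powr_half_sqrt)
    then have "(sqrt (sqrt q))^5 = q powr (5/4)" by (simp add: pow)
    moreover have "q^2 = q powr 2" using q by simp
    ultimately have "(sqrt (sqrt q))^5 / q^2 = q powr (5/4 - 2)" by (simp only: powr_diff)
    also have "\<dots> = (q powr (-3/16))^4" unfolding pow by simp
    finally show ?thesis .
  qed
  \<comment> \<open>Rounding 5 up to \<open>16 = 2^4\<close> yields the constant 2 after the fourth
    root.\<close>
  also have "5 * (q powr (-3/16))^4 * A^2 * N^2 \<le> 16 * (q powr (-3/16))^4 * A^2 * N^2"
    by (intro mult_right_mono) auto
  also have "\<dots> = (2 * q powr (-3/16) * sqrt A * sqrt N)^4"
  proof -
    have "(sqrt A)^4 = A^2" "(sqrt N)^4 = N^2"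
      using real_sqrt_pow2[of A] real_sqrt_pow2[of N] power_mult[of "sqrt A" 2 2] power_mult[of "sqrt N" 2 2]
      by (simp_all add: A_def N_def sum_nonneg)
    then show ?thesis by (simp add: power_mult_distrib)
  qed
  also have "(\<Sum>s\<in>residues. (cmod (Top p f1 f2 s))^2)^2 = (l2norm p (Top p f1 f2))^4"
  proof -
    have "(l2norm p (Top p f1 f2))^4 = ((l2norm p (Top p f1 f2))^2)^2" by (simp flip: power_mult)
    then show ?thesis by (simp add: l2norm_def sum_nonneg)
  qed
  finally have "(l2norm p (Top p f1 f2))^Suc 3 \<le> (2 * q powr (-3/16) * sqrt A * sqrt N)^Suc 3" by simp
  then have "l2norm p (Top p f1 f2) \<le> 2 * q powr (-3/16) * sqrt A * sqrt N"
    by (rule power_le_imp_le_base) (simp add: A_def N_def sum_nonneg)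
  then show ?thesis by (simp add: A_def N_def q_def l2norm_def)
qed

end

theorem theorem1p1:
  shows "\<exists>C>0. \<exists>P0::int. \<forall>p::int. prime p \<and> p > P0 \<longrightarrow>
     (\<forall>f1 f2 :: int \<Rightarrow> complex.
        l2norm p (Top p f1 f2) \<le> C * (real_of_int p) powr (-3/16) * l2norm p f1 * l2norm p f2)"
\<comment> \<open>The witness 2 serves for both \<open>C\<close> and \<open>P0\<close>; primes above
  2 are exactly the odd ones.\<close>
proof (intro exI[of _ 2] conjI allI impI)
  fix p :: int and f1 f2 :: "int \<Rightarrow> complex"
  assume "prime p \<and> 2 < p"
  then interpret odd_prime p by unfold_locales auto
  show "l2norm p (Top p f1 f2) \<le> 2 * (real_of_int p) powr (-3/16) * l2norm p f1 * l2norm p f2"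
    by (rule l2cmod_Top_le)
qed simp

end
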